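(* In the FJ-GA system (defined in the context), the steady-state average download time satisfies $$\mathbb{E}[T_{\text{FJ-GA}}] \ge \sum_{i=1}^k \frac{p_i}{(t+1)\mu - p_i\lambda}\quad\text{for } \lambda < \frac{(t+1)\mu}{\max\{p_1,\dots,p_k\}},$$ and $$\mathbb{E}[T_{\text{FJ-GA}}] \le \eta + \frac{\lambda \sum_{j=0}^{t}\binom{t}{j}(-1)^j \sum_{l=0}^{rj}(-1)^l\binom{rj}{l}(l+1)^{-2}}{\mu^2(1-\lambda\eta)}\quad\text{for } \lambda < 1/\eta,$$ where $\eta = \frac{1}{\mu r}\beta\!\left(t+1,\frac{1}{r}\right)$ and $\beta(x,y)=\int_0^1 v^{x-1}(1-v)^{y-1}dv$.
   Context: Storage model: $k$ objects $f_1,\dots,f_k$ are encoded by a systematic $(n,k)$ linear code and stored on $n$ servers, one symbol per server, with $(r,t)$-availability: for each systematic server $i$ there are $t$ pairwise disjoint recovery groups of $r$ servers (not containing server $i$), from any one of which $f_i$ can be recovered. Requests arrive as a Poisson process of rate $\lambda$; each request independently asks for $f_i$ with probability $p_i$ ($\sum_i p_i=1$). Fork-Join access (FJ-GA system): a request for $f_i$ is replicated into one copy at systematic server $i$ and one copy at each of its $t$ recovery groups; a copy at a recovery group is forked into $r$ sub-copies, one per server of the group, and completes when all sub-copies finish. The request completes when its systematic copy finishes or some recovery-group copy completes, and all outstanding copies/sub-copies are then removed immediately. Each server has a FCFS queue and serves one sub-copy at a time; service times are independent, each $\mathrm{Exp}(\mu)$. Download time is departure minus arrival time, in steady state. *)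

theory Defs
  imports "HOL-Probability.Probability"
begin

text \<open>Sample-path model of the FJ-GA system.
  Servers are natural numbers; file i (i < k) is stored on systematic server i.
  G i j (j < t) is the j-th recovery group of file i.
  Requests are numbered m = 0,1,2,... in order of arrival; request m arrives at
  time A m, asks for file fl m, and its sub-copy at server s (if any) needs
  service time S m s.  Every request places at most one sub-copy on each server.\<close>

definition used_servers :: "(nat \<Rightarrow> nat \<Rightarrow> nat set) \<Rightarrow> nat \<Rightarrow> nat \<Rightarrow> nat set" where
  "used_servers G t i = insert i (\<Union>j<t. G i j)"

text \<open>Completion time of a request for file i arriving at time a, when server s
  becomes free (for this request, FCFS) at time Fr s and the sub-copy at s needs
  service Sm s: the systematic copy or the first fully finished recovery group.\<close>
definition compl_time ::
  "(nat \<Rightarrow> nat \<Rightarrow> nat set) \<Rightarrow> nat \<Rightarrow> nat \<Rightarrow> real \<Rightarrow> (nat \<Rightarrow> real) \<Rightarrow> (nat \<Rightarrow> real) \<Rightarrow> real" where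
  "compl_time G t i a Fr Sm =
     (let C = (\<lambda>s. max a (Fr s) + Sm s)
      in Min (insert (C i) ((\<lambda>j. Max (C ` G i j)) ` {..<t})))"

text \<open>free m s: the time at which server s has finished with (or discarded) all
  sub-copies of requests 0..m-1.  The system starts empty at time 0.
  A sub-copy is removed as soon as its request completes (service interrupted
  or never started).\<close>
fun free_time ::
  "(nat \<Rightarrow> nat \<Rightarrow> nat set) \<Rightarrow> nat \<Rightarrow> (nat \<Rightarrow> real) \<Rightarrow> (nat \<Rightarrow> nat) \<Rightarrow> (nat \<Rightarrow> nat \<Rightarrow> real)
    \<Rightarrow> nat \<Rightarrow> nat \<Rightarrow> real" where
  "free_time G t A fl S 0 = (\<lambda>_. 0)"
| "free_time G t A fl S (Suc m) =
     (let Fr = free_time G t A fl S m;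
          D = compl_time G t (fl m) (A m) Fr (S m)
      in (\<lambda>s. if s \<in> used_servers G t (fl m)
               then max (Fr s) (min (max (A m) (Fr s) + S m s) D)
               else Fr s))"

definition download_time ::
  "(nat \<Rightarrow> nat \<Rightarrow> nat set) \<Rightarrow> nat \<Rightarrow> (nat \<Rightarrow> real) \<Rightarrow> (nat \<Rightarrow> nat) \<Rightarrow> (nat \<Rightarrow> nat \<Rightarrow> real)
    \<Rightarrow> nat \<Rightarrow> real" where
  "download_time G t A fl S m =
     compl_time G t (fl m) (A m) (free_time G t A fl S m) (S m) - A m"

text \<open>Index set of the primitive random inputs: interarrival times, file choices,
  service times (request m, server s).\<close>
datatype rv_index = IA nat | FC nat | SV nat nat

definition arrival :: "(rv_index \<Rightarrow> 'a \<Rightarrow> real) \<Rightarrow> 'a \<Rightarrow> nat \<Rightarrow> real" where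
  "arrival X \<omega> m = (\<Sum>j\<le>m. X (IA j) \<omega>)"

definition file_req :: "(rv_index \<Rightarrow> 'a \<Rightarrow> real) \<Rightarrow> 'a \<Rightarrow> nat \<Rightarrow> nat" where
  "file_req X \<omega> m = nat \<lfloor>X (FC m) \<omega>\<rfloor>"

definition service :: "(rv_index \<Rightarrow> 'a \<Rightarrow> real) \<Rightarrow> 'a \<Rightarrow> nat \<Rightarrow> nat \<Rightarrow> real" where
  "service X \<omega> m s = X (SV m s) \<omega>"

definition fjga_T :: "(nat \<Rightarrow> nat \<Rightarrow> nat set) \<Rightarrow> nat \<Rightarrow> (rv_index \<Rightarrow> 'a \<Rightarrow> real) \<Rightarrow> nat \<Rightarrow> 'a \<Rightarrow> real" where
  "fjga_T G t X m \<omega> = download_time G t (arrival X \<omega>) (file_req X \<omega>) (service X \<omega>) m"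

definition fjga_ET :: "'a measure \<Rightarrow> (nat \<Rightarrow> nat \<Rightarrow> nat set) \<Rightarrow> nat \<Rightarrow> (rv_index \<Rightarrow> 'a \<Rightarrow> real) \<Rightarrow> nat \<Rightarrow> ennreal" where
  "fjga_ET M G t X m = (\<integral>\<^sup>+ \<omega>. ennreal (fjga_T G t X m \<omega>) \<partial>M)"

end

theory Submission
  imports Defs
begin

text \<open>
  Completion and server release times are monotone in the release times left by earlier requests,
  so the waiting time of a request lies between the waiting times of two M/G/1 queues, both given by
  the Lindley recursion. From above, let every request hold all servers until it completes: the
  service time is then the minimum of one and \<open>t\<close> maxima of \<open>r\<close> exponential variables. From below,
  keep, for each file \<open>i\<close>, only the requests for \<open>i\<close> and only one server of each recovery group:
  all \<open>t + 1\<close> copies then start together, and the service time is exponential with rate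
  \<open>(t + 1) \<mu>\<close>.

  With exponential interarrival times, \<open>E ((v - I)\<^sup>+)\<^sup>q\<^sup>+\<^sup>1 + (q + 1) / \<lambda> * E ((v - I)\<^sup>+)\<^sup>q = v\<^sup>q\<^sup>+\<^sup>1\<close>. Started
  empty, the queue has moments nondecreasing in time, so \<open>q = 1\<close> bounds the mean waiting time by the
  Pollaczek--Khinchine value, and \<open>q = 2\<close> bounds the second moment, whose convergence turns that bound
  into the limit.
\<close>

section \<open>Moments of the waiting time in the M/G/1 queue\<close>

text \<open>Independence makes the joint law a product, and Tonelli integrates \<open>Y\<close> out.
  The outer integral stays over \<open>M\<close>, so facts holding almost everywhere in
  \<open>\<omega>\<close> can still be used inside it.\<close>

lemma (in prob_space) nn_integral_indep_var:
  fixes X Y :: "'a \<Rightarrow> real"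
  assumes ind: "indep_var borel X borel Y"
    and [measurable]: "f \<in> borel_measurable (borel \<Otimes>\<^sub>M borel)"
  shows "(\<integral>\<^sup>+\<omega>. f (X \<omega>, Y \<omega>) \<partial>M) = (\<integral>\<^sup>+\<omega>. (\<integral>\<^sup>+y. f (X \<omega>, y) \<partial>distr M borel Y) \<partial>M)"
proof -
  have [measurable]: "random_variable borel X" "random_variable borel Y"
    and d: "distr M borel X \<Otimes>\<^sub>M distr M borel Y = distr M (borel \<Otimes>\<^sub>M borel) (\<lambda>x. (X x, Y x))"
    using ind unfolding indep_var_distribution_eq by auto
  interpret Y: prob_space "distr M borel Y" by (rule prob_space_distr) simp
  have "(\<integral>\<^sup>+\<omega>. f (X \<omega>, Y \<omega>) \<partial>M) = (\<integral>\<^sup>+z. f z \<partial>(distr M borel X \<Otimes>\<^sub>M distr M borel Y))"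
    by (simp add: d nn_integral_distr)
  also have "\<dots> = (\<integral>\<^sup>+x. (\<integral>\<^sup>+y. f (x, y) \<partial>distr M borel Y) \<partial>distr M borel X)"
    by (rule Y.nn_integral_fst[symmetric]) simp
  also have "\<dots> = (\<integral>\<^sup>+\<omega>. (\<integral>\<^sup>+y. f (X \<omega>, y) \<partial>distr M borel Y) \<partial>M)"
    by (rule nn_integral_distr) auto
  finally show ?thesis .
qed

text \<open>Integration by parts. This identity replaces the idle-time analysis in the
  Pollaczek--Khinchine formula.\<close>

lemma nn_integral_exponential_positive_part_power:
  fixes l x :: real and q :: nat
  assumes l: "0 < l" and x: "0 \<le> x" and q: "1 \<le> q"
  shows "(\<integral>\<^sup>+y. ennreal (max 0 (x - y) ^ Suc q + real (Suc q) / l * max 0 (x - y) ^ q)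
            \<partial>density lborel (exponential_density l)) = ennreal (x ^ Suc q)"
proof -
  let ?f = "\<lambda>y. l * (x - y) ^ Suc q * exp (- l * y) + real (Suc q) * (x - y) ^ q * exp (- l * y)"
  let ?F = "\<lambda>y. - ((x - y) ^ Suc q * exp (- l * y))"
  have "(\<integral>\<^sup>+y. ennreal (max 0 (x - y) ^ Suc q + real (Suc q) / l * max 0 (x - y) ^ q)
            \<partial>density lborel (exponential_density l)) =
        (\<integral>\<^sup>+y. ennreal (exponential_density l y) *
            ennreal (max 0 (x - y) ^ Suc q + real (Suc q) / l * max 0 (x - y) ^ q) \<partial>lborel)"
    by (rule nn_integral_density) auto
  \<comment> \<open>The density vanishes for \<open>y < 0\<close> and both positive parts vanish for
    \<open>y \<ge> x\<close>; the latter uses \<open>q \<ge> 1\<close>, since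
    \<open>0 ^ 0 = 1\<close>.\<close>
  also have "\<dots> = (\<integral>\<^sup>+y. ennreal (?f y) * indicator {0..x} y \<partial>lborel)"
  proof (rule nn_integral_cong, goal_cases)
    case (1 y)
    have "exponential_density l y * (max 0 (x - y) ^ Suc q + real (Suc q) / l * max 0 (x - y) ^ q)
        = ?f y * indicator {0..x} y"
      using l q by (auto simp: exponential_density_def max_def field_simps indicator_def power_0_left)
    moreover have "0 \<le> max 0 (x - y) ^ Suc q + real (Suc q) / l * max 0 (x - y) ^ q"
      using l by (intro add_nonneg_nonneg mult_nonneg_nonneg) auto
    ultimately show ?case
      using l by (simp only: ennreal_mult'[symmetric] ennreal_indicator[symmetric]
          ennreal_mult''[symmetric] erlang_density_nonneg less_imp_le indicator_pos_le)
  qed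
  also have "\<dots> = ennreal (?F x - ?F 0)"
  proof (rule nn_integral_FTC_Icc)
    fix y assume "y \<in> {0..x}"
    show "DERIV ?F y :> ?f y"
      by (rule derivative_eq_intros refl)+ (simp add: algebra_simps)
    show "0 \<le> ?f y"
      using \<open>y \<in> {0..x}\<close> l by (intro add_nonneg_nonneg mult_nonneg_nonneg) auto
  qed (use x in auto)
  finally show ?thesis by simp
qed

lemma power_add_le_two_power:
  fixes a b :: real
  assumes "0 \<le> a" "0 \<le> b"
  shows "(a + b) ^ n \<le> 2 ^ n * (a ^ n + b ^ n)"
proof -
  have "(a + b) ^ n \<le> (2 * max a b) ^ n"
    using assms by (intro power_mono) auto
  also have "\<dots> = 2 ^ n * max a b ^ n"
    by (rule power_mult_distrib)
  also have "\<dots> \<le> 2 ^ n * (a ^ n + b ^ n)"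
    using assms by (intro mult_left_mono) (auto simp: max_def)
  finally show ?thesis .
qed

text \<open>For \<open>u \<ge> 0\<close>, \<open>u ^ k \<le> 1 + u ^ n\<close>, by the cases
  \<open>u \<le> 1\<close> and \<open>u > 1\<close>; constants are integrable under a probability
  measure.\<close>

lemma (in prob_space) integrable_power_le:
  fixes X :: "'a \<Rightarrow> real"
  assumes "integrable M (\<lambda>x. X x ^ n)" "k \<le> n" and [measurable]: "X \<in> borel_measurable M"
    and "AE x in M. 0 \<le> X x"
  shows "integrable M (\<lambda>x. X x ^ k)"
proof (rule Bochner_Integration.integrable_bound)
  show "integrable M (\<lambda>x. 1 + X x ^ n)" using assms by simp
  show "AE x in M. norm (X x ^ k) \<le> norm (1 + X x ^ n)"
    using assms(4)
  proof eventually_elim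
    case (elim x)
    have "X x ^ k \<le> 1 + X x ^ n"
    proof (cases "X x \<le> 1")
      case True
      then have "X x ^ k \<le> 1" using elim by (simp add: power_le_one)
      moreover have "0 \<le> X x ^ n" using elim by simp
      ultimately show ?thesis by linarith
    next
      case False
      then have "X x ^ k \<le> X x ^ n" using \<open>k \<le> n\<close> by (intro power_increasing) auto
      then show ?thesis by linarith
    qed
    then show ?case using elim by simp
  qed
qed simp

text \<open>\<open>I m\<close> is the time between the arrivals of customers \<open>m\<close> and \<open>m + 1\<close>.\<close>

locale mg1_waiting = prob_space +
  fixes W B I :: "nat \<Rightarrow> 'a \<Rightarrow> real" and D :: "real measure" and lam :: real
  assumes W_0: "W 0 \<omega> = 0"
    and W_Suc: "W (Suc m) \<omega> = max 0 (W m \<omega> + B m \<omega> - I m \<omega>)"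
    and indep_WB: "indep_var borel (W m) borel (B m)"
    and indep_VI: "indep_var borel (\<lambda>\<omega>. W m \<omega> + B m \<omega>) borel (I m)"
    and distr_I: "distributed M lborel (I m) (exponential_density lam)"
    and distr_B: "distr M borel (B m) = D"
    and B_nonneg: "AE \<omega> in M. 0 \<le> B m \<omega>"
    and lam_pos: "0 < lam"
begin

lemma W_measurable [measurable]: "W m \<in> borel_measurable M"
  using indep_WB indep_var_rv1 by blast

lemma B_measurable [measurable]: "B m \<in> borel_measurable M"
  using indep_WB indep_var_rv2 by blast

lemma W_nonneg: "0 \<le> W m \<omega>"
  by (cases m) (auto simp: W_0 W_Suc)

lemma I_nonneg: "AE \<omega> in M. 0 \<le> I m \<omega>"
  by (subst distributed_AE2[OF distr_I]) (auto simp: exponential_density_def)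

lemma distr_I_eq: "distr M borel (I m) = density lborel (exponential_density lam)"
  using distributed_distr_eq_density[OF distr_I, of m]
    distr_cong[OF refl sets_lborel, of M "I m" "I m"] by simp

lemma nn_integral_W_Suc:
  assumes [measurable]: "f \<in> borel_measurable borel"
  shows "(\<integral>\<^sup>+\<omega>. f (W (Suc m) \<omega>) \<partial>M) =
    (\<integral>\<^sup>+\<omega>. (\<integral>\<^sup>+y. f (max 0 (W m \<omega> + B m \<omega> - y)) \<partial>density lborel (exponential_density lam)) \<partial>M)"
  using nn_integral_indep_var[OF indep_VI, of "\<lambda>(v, y). f (max 0 (v - y))" m]
  by (simp add: W_Suc distr_I_eq)

text \<open>Stochastic monotonicity of a chain started at its least value. The transition kernel
  sends monotone functions to monotone functions, so the induction runs over all \<open>f\<close> at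
  once and passes from \<open>f\<close> to \<open>K\<close>.\<close>

lemma incseq_nn_integral_mono:
  assumes "mono f" and "f \<in> borel_measurable borel"
  shows "(\<integral>\<^sup>+\<omega>. f (W m \<omega>) \<partial>M) \<le> (\<integral>\<^sup>+\<omega>. f (W (Suc m) \<omega>) \<partial>M)"
  using assms
proof (induction m arbitrary: f)
  case (0 f)
  then show ?case
    by (intro nn_integral_mono) (auto simp: W_0 W_nonneg intro: monoD)
next
  case (Suc m f)
  note [measurable] = Suc.prems(2)
  let ?E = "density lborel (exponential_density lam)"
  interpret E: prob_space ?E by (rule prob_space_exponential_density) (rule lam_pos)
  interpret D: prob_space D using prob_space_distr[of "B 0" borel] distr_B[of 0] by auto
  have D_sets[measurable_cong, simp]: "sets D = sets borel"
    using distr_B[of 0, symmetric] by simp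
  define K where "K w = (\<integral>\<^sup>+b. (\<integral>\<^sup>+y. f (max 0 (w + b - y)) \<partial>?E) \<partial>D)" for w
  have [measurable]: "K \<in> borel_measurable borel"
    unfolding K_def by measurable
  have "mono K"
    unfolding K_def using Suc.prems(1)
    by (intro monoI nn_integral_mono) (auto intro!: monoD[OF Suc.prems(1)])
  \<comment> \<open>One kernel \<open>K\<close> serves all \<open>m\<close>, because the laws of
    \<open>B m\<close> and \<open>I m\<close> do not depend on \<open>m\<close>.\<close>
  have step: "(\<integral>\<^sup>+\<omega>. f (W (Suc m) \<omega>) \<partial>M) = (\<integral>\<^sup>+\<omega>. K (W m \<omega>) \<partial>M)" for m
    unfolding nn_integral_W_Suc[OF Suc.prems(2)] K_def
    using nn_integral_indep_var[OF indep_WB, of "\<lambda>(w, b). \<integral>\<^sup>+y. f (max 0 (w + b - y)) \<partial>?E" m]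
    by (simp add: distr_B)
  show ?case
    unfolding step by (rule Suc.IH) fact+
qed

lemma incseq_nn_moment:
  "(\<integral>\<^sup>+\<omega>. ennreal (W m \<omega> ^ q) \<partial>M) \<le> (\<integral>\<^sup>+\<omega>. ennreal (W (Suc m) \<omega> ^ q) \<partial>M)"
proof -
  \<comment> \<open>The positive part is inserted because \<open>x ^ q\<close> need not be monotone
    on negative reals; on the values of \<open>W\<close> it changes nothing.\<close>
  have "mono (\<lambda>x::real. ennreal (max 0 x ^ q))"
    by (intro monoI ennreal_leI power_mono) auto
  from incseq_nn_integral_mono[OF this, of m] show ?thesis
    by (simp add: W_nonneg max_absorb2)
qed

lemma integrable_B_power: "integrable M (\<lambda>\<omega>. B 0 \<omega> ^ q) \<Longrightarrow> integrable M (\<lambda>\<omega>. B m \<omega> ^ q)"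
  using integrable_distr_eq[of "B 0" M borel "\<lambda>x. x ^ q"]
    integrable_distr_eq[of "B m" M borel "\<lambda>x. x ^ q"] by (simp add: distr_B)

lemma integral_B_power: "expectation (\<lambda>\<omega>. B m \<omega> ^ q) = expectation (\<lambda>\<omega>. B 0 \<omega> ^ q)"
  using integral_distr[of "B 0" M borel "\<lambda>x. x ^ q"]
    integral_distr[of "B m" M borel "\<lambda>x. x ^ q"] by (simp add: distr_B)

lemma V_power_le: "AE \<omega> in M. norm ((W m \<omega> + B m \<omega>) ^ q) \<le> norm (2 ^ q * (W m \<omega> ^ q + B m \<omega> ^ q))"
  using B_nonneg[of m]
proof eventually_elim
  case (elim \<omega>)
  with power_add_le_two_power[OF W_nonneg elim, of m \<omega> q] show ?case
    by (simp add: W_nonneg)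
qed

text \<open>As \<open>I m \<ge> 0\<close>, \<open>W (Suc m) \<le> W m + B m\<close>, so each fixed
  \<open>W m\<close> inherits the moments of the service time by induction, whether or not the queue
  is stable.\<close>

lemma integrable_W_power:
  assumes "integrable M (\<lambda>\<omega>. B 0 \<omega> ^ q)"
  shows "integrable M (\<lambda>\<omega>. W m \<omega> ^ q)"
proof (induction m)
  case 0
  show ?case by (simp add: W_0)
next
  case (Suc m)
  show ?case
  proof (rule Bochner_Integration.integrable_bound)
    show "integrable M (\<lambda>\<omega>. 2 ^ q * (W m \<omega> ^ q + B m \<omega> ^ q))"
      using Suc integrable_B_power[OF assms, of m] by simp
    show "AE \<omega> in M. norm (W (Suc m) \<omega> ^ q) \<le> norm (2 ^ q * (W m \<omega> ^ q + B m \<omega> ^ q))"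
      using V_power_le[of m q] B_nonneg[of m] I_nonneg[of m]
    proof eventually_elim
      case (elim \<omega>)
      have "W (Suc m) \<omega> ^ q \<le> (W m \<omega> + B m \<omega>) ^ q"
        using elim W_nonneg[of m \<omega>] by (intro power_mono) (auto simp: W_Suc)
      with elim W_nonneg[of "Suc m" \<omega>] W_nonneg[of m \<omega>] show ?case by simp
    qed
  qed simp
qed

lemma integrable_V_power:
  assumes "integrable M (\<lambda>\<omega>. B 0 \<omega> ^ q)"
  shows "integrable M (\<lambda>\<omega>. (W m \<omega> + B m \<omega>) ^ q)"
proof (rule Bochner_Integration.integrable_bound)
  show "integrable M (\<lambda>\<omega>. 2 ^ q * (W m \<omega> ^ q + B m \<omega> ^ q))"
    using integrable_W_power[OF assms, of m] integrable_B_power[OF assms, of m] by simp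
qed (simp, rule V_power_le)

section \<open>Moment recursions and the Pollaczek-Khinchine mean\<close>

lemma incseq_moment:
  assumes "integrable M (\<lambda>\<omega>. B 0 \<omega> ^ q)"
  shows "expectation (\<lambda>\<omega>. W m \<omega> ^ q) \<le> expectation (\<lambda>\<omega>. W (Suc m) \<omega> ^ q)"
  using incseq_nn_moment[of m q] integrable_W_power[OF assms]
  by (simp add: nn_integral_eq_integral W_nonneg Bochner_Integration.integral_nonneg)

text \<open>The exponential identity is applied with \<open>W m + B m\<close> held fixed; the
  combination of two moments on the left is the one for which integrating out \<open>I m\<close>
  leaves a plain power.\<close>

lemma moment_recursion:
  assumes int: "integrable M (\<lambda>\<omega>. B 0 \<omega> ^ Suc q)" and q: "1 \<le> q"
  shows "expectation (\<lambda>\<omega>. W (Suc m) \<omega> ^ Suc q) +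
      real (Suc q) / lam * expectation (\<lambda>\<omega>. W (Suc m) \<omega> ^ q) =
    expectation (\<lambda>\<omega>. (W m \<omega> + B m \<omega>) ^ Suc q)"
proof -
  have int': "integrable M (\<lambda>\<omega>. B 0 \<omega> ^ q)"
    by (rule integrable_power_le[OF int _ _ B_nonneg]) auto
  note W_int = integrable_W_power[OF int, of "Suc m"] integrable_W_power[OF int', of "Suc m"]
  have "ennreal (expectation (\<lambda>\<omega>. W (Suc m) \<omega> ^ Suc q +
      real (Suc q) / lam * W (Suc m) \<omega> ^ q)) =
    (\<integral>\<^sup>+\<omega>. ennreal (W (Suc m) \<omega> ^ Suc q + real (Suc q) / lam * W (Suc m) \<omega> ^ q) \<partial>M)"
    using W_int lam_pos
    by (intro nn_integral_eq_integral[symmetric])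
       (auto intro!: add_nonneg_nonneg mult_nonneg_nonneg simp: W_nonneg)
  also have "\<dots> = (\<integral>\<^sup>+\<omega>. (\<integral>\<^sup>+y. ennreal (max 0 (W m \<omega> + B m \<omega> - y) ^ Suc q
      + real (Suc q) / lam * max 0 (W m \<omega> + B m \<omega> - y) ^ q)
      \<partial>density lborel (exponential_density lam)) \<partial>M)"
    by (rule nn_integral_W_Suc) measurable
  also have "\<dots> = (\<integral>\<^sup>+\<omega>. ennreal ((W m \<omega> + B m \<omega>) ^ Suc q) \<partial>M)"
  proof (rule nn_integral_cong_AE)
    show "AE \<omega> in M. (\<integral>\<^sup>+y. ennreal (max 0 (W m \<omega> + B m \<omega> - y) ^ Suc q
      + real (Suc q) / lam * max 0 (W m \<omega> + B m \<omega> - y) ^ q)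
      \<partial>density lborel (exponential_density lam)) = ennreal ((W m \<omega> + B m \<omega>) ^ Suc q)"
      using B_nonneg[of m]
    proof eventually_elim
      case (elim \<omega>)
      then show ?case
        by (intro nn_integral_exponential_positive_part_power lam_pos q) (simp add: W_nonneg)
    qed
  qed
  also have "\<dots> = ennreal (expectation (\<lambda>\<omega>. (W m \<omega> + B m \<omega>) ^ Suc q))"
  proof (rule nn_integral_eq_integral[OF integrable_V_power[OF int]])
    show "AE \<omega> in M. 0 \<le> (W m \<omega> + B m \<omega>) ^ Suc q"
      using B_nonneg[of m] by eventually_elim (simp add: W_nonneg)
  qed
  finally have "expectation (\<lambda>\<omega>. W (Suc m) \<omega> ^ Suc q + real (Suc q) / lam * W (Suc m) \<omega> ^ q)
      = expectation (\<lambda>\<omega>. (W m \<omega> + B m \<omega>) ^ Suc q)"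
  proof (rule ennreal_inj[THEN iffD1, rotated 2])
    show "0 \<le> expectation (\<lambda>\<omega>. W (Suc m) \<omega> ^ Suc q + real (Suc q) / lam * W (Suc m) \<omega> ^ q)"
      using lam_pos
      by (intro Bochner_Integration.integral_nonneg add_nonneg_nonneg mult_nonneg_nonneg) (auto simp: W_nonneg)
    have "AE \<omega> in M. 0 \<le> (W m \<omega> + B m \<omega>) ^ Suc q"
      using B_nonneg[of m] by eventually_elim (simp add: W_nonneg)
    then show "0 \<le> expectation (\<lambda>\<omega>. (W m \<omega> + B m \<omega>) ^ Suc q)"
      by (rule integral_nonneg_AE)
  qed
  then show ?thesis
    using W_int by simp
qed

lemma expectation_W_B_power:
  assumes "integrable M (\<lambda>\<omega>. W m \<omega> ^ i)" "integrable M (\<lambda>\<omega>. B m \<omega> ^ j)"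
  shows "integrable M (\<lambda>\<omega>. W m \<omega> ^ i * B m \<omega> ^ j)"
    and "expectation (\<lambda>\<omega>. W m \<omega> ^ i * B m \<omega> ^ j) =
      expectation (\<lambda>\<omega>. W m \<omega> ^ i) * expectation (\<lambda>\<omega>. B 0 \<omega> ^ j)"
proof -
  have "indep_var borel ((\<lambda>x. x ^ i) \<circ> W m) borel ((\<lambda>x. x ^ j) \<circ> B m)"
    by (rule indep_var_compose[OF indep_WB]) auto
  then have ind: "indep_var borel (\<lambda>\<omega>. W m \<omega> ^ i) borel (\<lambda>\<omega>. B m \<omega> ^ j)"
    by (simp add: comp_def)
  show "integrable M (\<lambda>\<omega>. W m \<omega> ^ i * B m \<omega> ^ j)"
    by (rule indep_var_integrable[OF ind]) fact+
  show "expectation (\<lambda>\<omega>. W m \<omega> ^ i * B m \<omega> ^ j) =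
      expectation (\<lambda>\<omega>. W m \<omega> ^ i) * expectation (\<lambda>\<omega>. B 0 \<omega> ^ j)"
    using indep_var_lebesgue_integral[OF ind assms] integral_B_power[of m j] by simp
qed

lemma expectation_V_power:
  assumes int: "integrable M (\<lambda>\<omega>. B 0 \<omega> ^ n)"
  shows "expectation (\<lambda>\<omega>. (W m \<omega> + B m \<omega>) ^ n) =
    (\<Sum>i\<le>n. real (n choose i) * expectation (\<lambda>\<omega>. W m \<omega> ^ i) * expectation (\<lambda>\<omega>. B 0 \<omega> ^ (n - i)))"
proof -
  have B: "integrable M (\<lambda>\<omega>. B 0 \<omega> ^ i)" if "i \<le> n" for i
    by (rule integrable_power_le[OF int that _ B_nonneg]) simp
  note * = expectation_W_B_power[OF integrable_W_power[OF B] integrable_B_power[OF B]]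
  have "expectation (\<lambda>\<omega>. (W m \<omega> + B m \<omega>) ^ n) =
    expectation (\<lambda>\<omega>. \<Sum>i\<le>n. real (n choose i) * (W m \<omega> ^ i * B m \<omega> ^ (n - i)))"
    by (simp add: binomial_ring mult.assoc)
  also have "\<dots> = (\<Sum>i\<le>n. real (n choose i) * expectation (\<lambda>\<omega>. W m \<omega> ^ i * B m \<omega> ^ (n - i)))"
    by (subst Bochner_Integration.integral_sum) (auto intro!: integrable_mult_right *)
  also have "\<dots> = (\<Sum>i\<le>n. real (n choose i) * expectation (\<lambda>\<omega>. W m \<omega> ^ i) * expectation (\<lambda>\<omega>. B 0 \<omega> ^ (n - i)))"
    by (intro sum.cong) (auto simp: *)
  finally show ?thesis .
qed

text \<open>The case \<open>q = 1\<close>. The second moments of successive waiting times enter with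
  the same coefficient 1, so they can be compared or cancelled.\<close>

lemma second_moment_recursion:
  assumes int: "integrable M (\<lambda>\<omega>. B 0 \<omega> ^ 2)"
  shows "expectation (\<lambda>\<omega>. W (Suc m) \<omega> ^ 2) + 2 / lam * expectation (W (Suc m)) =
    expectation (\<lambda>\<omega>. W m \<omega> ^ 2) + 2 * expectation (W m) * expectation (B 0)
      + expectation (\<lambda>\<omega>. B 0 \<omega> ^ 2)"
  using moment_recursion[of 1 m] expectation_V_power[OF int, of m] int
  by (simp add: numeral_2_eq_2 sum.atMost_Suc prob_space)

lemma third_moment_recursion:
  assumes int: "integrable M (\<lambda>\<omega>. B 0 \<omega> ^ 3)"
  shows "expectation (\<lambda>\<omega>. W (Suc m) \<omega> ^ 3) + 3 / lam * expectation (\<lambda>\<omega>. W (Suc m) \<omega> ^ 2) =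
    expectation (\<lambda>\<omega>. W m \<omega> ^ 3) + 3 * expectation (\<lambda>\<omega>. W m \<omega> ^ 2) * expectation (B 0)
      + 3 * expectation (W m) * expectation (\<lambda>\<omega>. B 0 \<omega> ^ 2) + expectation (\<lambda>\<omega>. B 0 \<omega> ^ 3)"
  using moment_recursion[of 2 m] expectation_V_power[OF int, of m] int
  by (simp add: numeral_3_eq_3 numeral_2_eq_2 sum.atMost_Suc prob_space)

text \<open>The second moments are nondecreasing in \<open>m\<close>, so they drop out of
  \<open>second_moment_recursion\<close> and leave an inequality. Replacing the mean of
  \<open>W (Suc m)\<close> by that of \<open>W m\<close> makes it linear in one unknown, solvable
  because the load is below one.\<close>

theorem pollaczek_khinchine_le:
  assumes int: "integrable M (\<lambda>\<omega>. B 0 \<omega> ^ 2)" and rho: "lam * expectation (B 0) < 1"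
  shows "expectation (W m) \<le>
    lam * expectation (\<lambda>\<omega>. B 0 \<omega> ^ 2) / (2 * (1 - lam * expectation (B 0)))"
proof -
  have int1: "integrable M (\<lambda>\<omega>. B 0 \<omega> ^ 1)"
    by (rule integrable_power_le[OF int _ _ B_nonneg]) auto
  have mono1: "expectation (W m) \<le> expectation (W (Suc m))"
    using incseq_moment[OF int1, of m] by simp
  have "2 / lam * expectation (W (Suc m)) \<le>
      2 * expectation (W m) * expectation (B 0) + expectation (\<lambda>\<omega>. B 0 \<omega> ^ 2)"
    using second_moment_recursion[OF int, of m] incseq_moment[OF int, of m] by linarith
  moreover have "2 / lam * expectation (W m) \<le> 2 / lam * expectation (W (Suc m))"
    using mono1 lam_pos by (intro mult_left_mono) auto
  ultimately have "2 / lam * expectation (W m) \<le>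
      2 * expectation (W m) * expectation (B 0) + expectation (\<lambda>\<omega>. B 0 \<omega> ^ 2)"
    by linarith
  then show ?thesis
    using lam_pos rho by (simp add: field_simps)
qed

text \<open>The mean and the second moment increase to finite limits, so the second moments cancel
  in the limit of \<open>second_moment_recursion\<close> and the limit mean satisfies a linear
  equation. The third moment of \<open>B\<close> serves to bound the second moment of the
  wait.\<close>

theorem pollaczek_khinchine_tendsto:
  assumes int: "integrable M (\<lambda>\<omega>. B 0 \<omega> ^ 3)" and rho: "lam * expectation (B 0) < 1"
  shows "(\<lambda>m. expectation (W m)) \<longlonglongrightarrow>
    lam * expectation (\<lambda>\<omega>. B 0 \<omega> ^ 2) / (2 * (1 - lam * expectation (B 0)))"
proof -
  define w where "w q m = expectation (\<lambda>\<omega>. W m \<omega> ^ q)" for q m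
  define b where "b q = expectation (\<lambda>\<omega>. B 0 \<omega> ^ q)" for q
  have int': "integrable M (\<lambda>\<omega>. B 0 \<omega> ^ q)" if "q \<le> 3" for q
    by (rule integrable_power_le[OF int that _ B_nonneg]) auto
  have mono: "w q m \<le> w q (Suc m)" if "q \<le> 3" for q m
    unfolding w_def by (rule incseq_moment[OF int'[OF that]])
  then have inc: "incseq (w q)" if "q \<le> 3" for q
    using that by (auto simp: incseq_Suc_iff)
  have bounded1: "w 1 m \<le> lam * b 2 / (2 * (1 - lam * b 1))" for m
    using pollaczek_khinchine_le[OF int'[of 2], of m] rho by (simp add: w_def b_def)
  have b_nonneg: "0 \<le> b q" for q
    unfolding b_def
    by (rule integral_nonneg_AE) (use B_nonneg[of 0] in \<open>eventually_elim, simp\<close>)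
  have rho': "lam * b 1 < 1"
    using rho by (simp add: b_def)
  \<comment> \<open>The argument of \<open>pollaczek_khinchine_le\<close> one degree higher: the
    third moments drop out by monotonicity, and the mean is replaced by its bound.\<close>
  have bounded2: "w 2 m \<le> lam * (3 * (lam * b 2 / (2 * (1 - lam * b 1))) * b 2 + b 3) / (3 * (1 - lam * b 1))"
    for m
  proof -
    have "3 / lam * w 2 (Suc m) \<le> 3 * w 2 m * b 1 + 3 * w 1 m * b 2 + b 3"
      using third_moment_recursion[OF int, of m] mono[of 3 m] by (simp add: w_def b_def)
    moreover have "3 / lam * w 2 m \<le> 3 / lam * w 2 (Suc m)"
      using mono[of 2 m] lam_pos by (intro mult_left_mono) auto
    moreover have "3 * w 1 m * b 2 \<le> 3 * (lam * b 2 / (2 * (1 - lam * b 1))) * b 2"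
      using bounded1 b_nonneg by (intro mult_right_mono mult_left_mono) auto
    moreover define c where "c = 3 * (lam * b 2 / (2 * (1 - lam * b 1))) * b 2 + b 3"
    ultimately have "3 / lam * w 2 m \<le> 3 * w 2 m * b 1 + c"
      by linarith
    then have "lam * (3 / lam * w 2 m) \<le> lam * (3 * w 2 m * b 1 + c)"
      using lam_pos by (intro mult_left_mono) auto
    then have "w 2 m * (3 * (1 - lam * b 1)) \<le> lam * c"
      using lam_pos by (simp add: algebra_simps)
    then show ?thesis
      unfolding c_def[symmetric] using rho' by (subst pos_le_divide_eq) auto
  qed
  obtain L1 where L1: "w 1 \<longlonglongrightarrow> L1"
    by (rule incseq_convergent[OF inc[of 1] allI[OF bounded1]]) auto
  obtain L2 where L2: "w 2 \<longlonglongrightarrow> L2"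
    by (rule incseq_convergent[OF inc[of 2] allI[OF bounded2]]) auto
  have rec: "w 2 (Suc m) + 2 / lam * w 1 (Suc m) = w 2 m + 2 * w 1 m * b 1 + b 2" for m
    using second_moment_recursion[OF int'[of 2], of m] by (simp add: w_def b_def)
  have "(\<lambda>m. w 2 (Suc m) + 2 / lam * w 1 (Suc m)) \<longlonglongrightarrow> L2 + 2 / lam * L1"
    by (intro tendsto_intros LIMSEQ_Suc L1 L2)
  moreover have "(\<lambda>m. w 2 (Suc m) + 2 / lam * w 1 (Suc m)) \<longlonglongrightarrow> L2 + 2 * L1 * b 1 + b 2"
    unfolding rec by (intro tendsto_intros L1 L2)
  ultimately have "L2 + 2 / lam * L1 = L2 + 2 * L1 * b 1 + b 2"
    by (rule LIMSEQ_unique)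
  then have "L1 = lam * b 2 / (2 * (1 - lam * b 1))"
    using lam_pos rho' by (simp add: field_simps)
  moreover have "w 1 = (\<lambda>m. expectation (W m))"
    by (simp add: w_def fun_eq_iff)
  ultimately show ?thesis
    using L1 by (simp add: b_def)
qed

end

section \<open>Sample path bounds\<close>

text \<open>The time a request would take if all its sub-copies started simultaneously.\<close>

definition batch_service ::
  "(nat \<Rightarrow> nat \<Rightarrow> nat set) \<Rightarrow> nat \<Rightarrow> nat \<Rightarrow> (nat \<Rightarrow> real) \<Rightarrow> real" where
  "batch_service G t i Sm = Min (insert (Sm i) ((\<lambda>j. Max (Sm ` G i j)) ` {..<t}))"

text \<open>The pathwise form of the recursion in \<open>mg1_waiting\<close>; \<open>d m\<close> is
  the gap between requests \<open>m\<close> and \<open>m + 1\<close>.\<close>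

primrec lindley :: "(nat \<Rightarrow> real) \<Rightarrow> (nat \<Rightarrow> real) \<Rightarrow> nat \<Rightarrow> real" where
  "lindley b d 0 = 0"
| "lindley b d (Suc m) = max 0 (lindley b d m + b m - d m)"

lemma lindley_nonneg: "0 \<le> lindley b d m"
  by (cases m) auto

lemma batch_service_nonneg:
  assumes "\<And>j. j < t \<Longrightarrow> finite (G i j) \<and> G i j \<noteq> {}" "\<And>s. 0 \<le> Sm s"
  shows "0 \<le> batch_service G t i Sm"
proof -
  have "0 \<le> Max (Sm ` G i j)" if "j < t" for j
    using assms(1)[OF that] assms(2) by (subst Max_ge_iff) auto
  then show ?thesis
    unfolding batch_service_def using assms(2) by (subst Min_ge_iff) auto
qed

text \<open>Each copy starts by \<open>a + w\<close>, so it ends by \<open>a + w\<close> plus its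
  service time; the maximum over a group and the minimum over the alternatives respect such a
  shift.\<close>

lemma compl_time_le:
  assumes fin: "\<And>j. j < t \<Longrightarrow> finite (G i j) \<and> G i j \<noteq> {}"
    and Fr: "\<And>s. Fr s \<le> a + w" and w: "0 \<le> w"
  shows "compl_time G t i a Fr Sm \<le> a + w + batch_service G t i Sm"
proof -
  let ?C = "\<lambda>s. max a (Fr s) + Sm s"
  have C: "?C s \<le> a + w + Sm s" for s
    using Fr[of s] w by auto
  have compl: "compl_time G t i a Fr Sm = Min (insert (?C i) ((\<lambda>j. Max (?C ` G i j)) ` {..<t}))"
    by (simp add: compl_time_def Let_def)
  have "batch_service G t i Sm \<in> insert (Sm i) ((\<lambda>j. Max (Sm ` G i j)) ` {..<t})"
    unfolding batch_service_def by (rule Min_in) auto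
  then consider "batch_service G t i Sm = Sm i"
    | j where "j < t" "batch_service G t i Sm = Max (Sm ` G i j)" by auto
  then show ?thesis
  proof cases
    case 1
    have "compl_time G t i a Fr Sm \<le> ?C i" unfolding compl by (rule Min_le) auto
    with C[of i] 1 show ?thesis by linarith
  next
    case (2 j)
    have "compl_time G t i a Fr Sm \<le> Max (?C ` G i j)"
      unfolding compl using 2 by (intro Min_le) auto
    also have "\<dots> \<le> a + w + Max (Sm ` G i j)"
    proof (rule Max.boundedI)
      fix c assume "c \<in> ?C ` G i j"
      then obtain s where s: "s \<in> G i j" "c = ?C s" by auto
      have "Sm s \<le> Max (Sm ` G i j)" using fin[OF 2(1)] s by (intro Max_ge) auto
      with C[of s] s show "c \<le> a + w + Max (Sm ` G i j)" by linarith
    qed (use fin[OF 2(1)] in auto)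
    finally show ?thesis using 2 by simp
  qed
qed

text \<open>\<open>R\<close> contains the systematic server and meets every recovery group, so each
  way to complete the request includes a full service at a server of \<open>R\<close>, and none of
  these starts before \<open>a + w\<close>.\<close>

lemma compl_time_ge:
  assumes fin: "\<And>j. j < t \<Longrightarrow> finite (G i j)" and R: "finite R" "i \<in> R"
    and rep: "\<And>j. j < t \<Longrightarrow> G i j \<inter> R \<noteq> {}"
    and Fr: "\<And>s. s \<in> R \<Longrightarrow> a + w \<le> max a (Fr s)"
  shows "a + w + Min (Sm ` R) \<le> compl_time G t i a Fr Sm"
proof -
  let ?C = "\<lambda>s. max a (Fr s) + Sm s"
  have C: "a + w + Min (Sm ` R) \<le> ?C s" if "s \<in> R" for s
  proof -
    have "Min (Sm ` R) \<le> Sm s" using that R by (intro Min_le) auto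
    with Fr[OF that] show ?thesis by linarith
  qed
  have "a + w + Min (Sm ` R) \<le> Max (?C ` G i j)" if j: "j < t" for j
  proof -
    obtain s where s: "s \<in> G i j" "s \<in> R" using rep[OF j] by auto
    have "?C s \<le> Max (?C ` G i j)" using fin[OF j] s by (intro Max_ge) auto
    with C[OF s(2)] show ?thesis by linarith
  qed
  then show ?thesis
    using C[OF R(2)] by (simp add: compl_time_def Let_def)
qed

lemma free_time_mono: "free_time G t A fl S m s \<le> free_time G t A fl S (Suc m) s"
  by (simp add: Let_def)

text \<open>Induction with \<open>A m + lindley b d m\<close> bounding all release times at once.
  Request \<open>m\<close> leaves each server free no later than the larger of its old release time
  and the completion time, hence no later than that bound plus \<open>b m\<close>.\<close>

lemma free_time_le_lindley:
  assumes fin: "\<And>m j. j < t \<Longrightarrow> finite (G (fl m) j) \<and> G (fl m) j \<noteq> {}"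
    and S: "\<And>m s. 0 \<le> S m s" and A: "0 \<le> A 0"
    and b: "\<And>m. b m = batch_service G t (fl m) (S m)"
    and d: "\<And>m. d m = A (Suc m) - A m"
  shows "free_time G t A fl S m s \<le> A m + lindley b d m"
proof (induction m arbitrary: s)
  case 0
  show ?case using A by simp
next
  case (Suc m)
  have "compl_time G t (fl m) (A m) (free_time G t A fl S m) (S m) \<le> A m + lindley b d m + b m"
    unfolding b by (rule compl_time_le) (use fin Suc.IH lindley_nonneg in \<open>auto simp: b\<close>)
  moreover have "0 \<le> b m"
    unfolding b by (rule batch_service_nonneg) (use fin S in auto)
  ultimately have "free_time G t A fl S (Suc m) s \<le> A m + lindley b d m + b m"
    using Suc.IH[of s] by (auto simp: Let_def)
  also have "\<dots> \<le> A (Suc m) + lindley b d (Suc m)"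
    using d[of m] by simp
  finally show ?case .
qed

lemma download_time_le_lindley:
  assumes "\<And>m j. j < t \<Longrightarrow> finite (G (fl m) j) \<and> G (fl m) j \<noteq> {}"
    and "\<And>m s. 0 \<le> S m s" and "0 \<le> A 0"
    and b: "\<And>m. b m = batch_service G t (fl m) (S m)"
    and "\<And>m. d m = A (Suc m) - A m"
  shows "download_time G t A fl S m \<le> lindley b d m + b m"
proof -
  have "free_time G t A fl S m s \<le> A m + lindley b d m" for s
    by (rule free_time_le_lindley) (use assms in auto)
  then have "compl_time G t (fl m) (A m) (free_time G t A fl S m) (S m) \<le> A m + lindley b d m + b m"
    unfolding b[of m] by (intro compl_time_le assms(1) lindley_nonneg)
  then show ?thesis
    unfolding download_time_def by linarith
qed

text \<open>A server of \<open>R\<close> may be idle before \<open>A m\<close>, hence the maximum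
  with \<open>A m\<close>. The servers of \<open>R\<close> need not stay in step: the claim is a
  common lower bound on the times at which they can begin request \<open>m\<close>.\<close>

lemma lindley_le_free_time:
  assumes fin: "\<And>j. j < t \<Longrightarrow> finite (G i j)"
    and R: "finite R" "i \<in> R" "R \<subseteq> used_servers G t i"
    and rep: "\<And>j. j < t \<Longrightarrow> G i j \<inter> R \<noteq> {}"
    and b: "\<And>m. b m = (if fl m = i then Min (S m ` R) else 0)"
    and d: "\<And>m. d m = A (Suc m) - A m" "\<And>m. 0 \<le> d m"
    and s: "s \<in> R"
  shows "A m + lindley b d m \<le> max (A m) (free_time G t A fl S m s)"
  using s
proof (induction m arbitrary: s)
  case 0
  show ?case by simp
next
  case (Suc m)
  let ?Fr = "free_time G t A fl S m"
  have "A m + lindley b d m + b m \<le> max (A (Suc m)) (free_time G t A fl S (Suc m) s)"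
  proof (cases "fl m = i")
    case True
    \<comment> \<open>Server \<open>s\<close> is released when its own sub-copy ends or when the
      request completes, whichever is first; both times have the required lower bound.\<close>
    have "A m + lindley b d m + Min (S m ` R) \<le> compl_time G t i (A m) ?Fr (S m)"
      by (rule compl_time_ge) (use fin R rep Suc.IH in auto)
    moreover have "Min (S m ` R) \<le> S m s"
      using Suc.prems R by (intro Min_le) auto
    then have "A m + lindley b d m + Min (S m ` R) \<le> max (A m) (?Fr s) + S m s"
      using Suc.IH[OF Suc.prems] by linarith
    moreover have "s \<in> used_servers G t (fl m)"
      using Suc.prems R True by auto
    ultimately have "A m + lindley b d m + Min (S m ` R) \<le> free_time G t A fl S (Suc m) s"
      using True by (simp add: Let_def)
    then show ?thesis
      using True b[of m] by simp
  next
    \<comment> \<open>A request for another file counts as zero service: it can delay the servers of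
      \<open>R\<close> but never releases one earlier.\<close>
    case False
    then show ?thesis
      using b[of m] Suc.IH[OF Suc.prems] free_time_mono[of G t A fl S m s] d[of m] by auto
  qed
  then show ?case
    using d[of m] by auto
qed

lemma lindley_le_download_time:
  assumes "\<And>j. j < t \<Longrightarrow> finite (G i j)"
    and "finite R" "i \<in> R" "R \<subseteq> used_servers G t i"
    and "\<And>j. j < t \<Longrightarrow> G i j \<inter> R \<noteq> {}"
    and "\<And>m. b m = (if fl m = i then Min (S m ` R) else 0)"
    and "\<And>m. d m = A (Suc m) - A m" "\<And>m. 0 \<le> d m"
    and i: "fl m = i"
  shows "lindley b d m + Min (S m ` R) \<le> download_time G t A fl S m"
proof -
  have Fr: "A m + lindley b d m \<le> max (A m) (free_time G t A fl S m s)" if "s \<in> R" for s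
    by (rule lindley_le_free_time) (fact assms that)+
  have "A m + lindley b d m + Min (S m ` R) \<le> compl_time G t i (A m) (free_time G t A fl S m) (S m)"
    by (rule compl_time_ge) (fact assms Fr)+
  then show ?thesis
    unfolding download_time_def i by linarith
qed

text \<open>Inputs with index at least \<open>m\<close> do not enter, which makes the waiting time
  of request \<open>m\<close> a function of the past.\<close>

lemma lindley_cong:
  "(\<And>j. j < m \<Longrightarrow> b j = b' j) \<Longrightarrow> (\<And>j. j < m \<Longrightarrow> d j = d' j) \<Longrightarrow> lindley b d m = lindley b' d' m"
  by (induction m) auto

lemma borel_measurable_lindley [measurable (raw)]:
  assumes "\<And>j. j < m \<Longrightarrow> (\<lambda>x. b x j) \<in> borel_measurable N"
    and "\<And>j. j < m \<Longrightarrow> (\<lambda>x. d x j) \<in> borel_measurable N"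
  shows "(\<lambda>x. lindley (b x) (d x) m) \<in> borel_measurable N"
  using assms by (induction m) auto

section \<open>Moments from tails\<close>

text \<open>For nonnegative variables the tails at \<open>x \<ge> 0\<close> fix the distribution
  function, which is zero below 0. This turns tail computations into the equality of laws demanded
  by \<open>mg1_waiting\<close>.\<close>

lemma (in prob_space) distr_eq_if_tail_eq:
  fixes X Y :: "'a \<Rightarrow> real"
  assumes [measurable]: "X \<in> borel_measurable M" "Y \<in> borel_measurable M"
    and "AE \<omega> in M. 0 \<le> X \<omega>" "AE \<omega> in M. 0 \<le> Y \<omega>"
    and tail: "\<And>x. 0 \<le> x \<Longrightarrow> \<P>(\<omega> in M. x < X \<omega>) = \<P>(\<omega> in M. x < Y \<omega>)"
  shows "distr M borel X = distr M borel Y"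
proof (rule cdf_unique)
  show "real_distribution (distr M borel X)" "real_distribution (distr M borel Y)"
    by (auto intro!: real_distribution_distr)
  have cdf: "cdf (distr M borel Z) x = (if x < 0 then 0 else 1 - \<P>(\<omega> in M. x < Z \<omega>))"
    if [measurable]: "Z \<in> borel_measurable M" and nn: "AE \<omega> in M. 0 \<le> Z \<omega>" for Z :: "'a \<Rightarrow> real" and x
  proof -
    have "cdf (distr M borel Z) x = \<P>(\<omega> in M. Z \<omega> \<le> x)"
      by (simp add: cdf_def measure_distr vimage_def Int_def conj_commute)
    moreover have "\<P>(\<omega> in M. Z \<omega> \<le> x) = 0" if "x < 0"
    proof -
      have "AE \<omega> in M. \<not> Z \<omega> \<le> x" using nn by eventually_elim (use that in auto)
      then show ?thesis by (subst prob_eq_0) auto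
    qed
    moreover have "\<P>(\<omega> in M. x < Z \<omega>) = 1 - \<P>(\<omega> in M. Z \<omega> \<le> x)"
      using prob_neg[of "\<lambda>\<omega>. Z \<omega> \<le> x"] by (simp add: not_le)
    ultimately show ?thesis by simp
  qed
  show "cdf (distr M borel X) = cdf (distr M borel Y)"
    using assms by (auto simp: cdf fun_eq_iff)
qed

text \<open>Layer-cake formula: \<open>X \<omega> ^ Suc q\<close> is the integral of
  \<open>Suc q * x ^ q\<close> over \<open>0 \<le> x < X \<omega>\<close>, and Tonelli exchanges the
  integrals. Working in \<open>ennreal\<close> gives integrability together with the value.\<close>

lemma (in prob_space) has_bochner_integral_power_tail:
  fixes X :: "'a \<Rightarrow> real"
  assumes [measurable]: "X \<in> borel_measurable M" and nn: "AE \<omega> in M. 0 \<le> X \<omega>"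
    and tail: "\<And>x. 0 \<le> x \<Longrightarrow> \<P>(\<omega> in M. x < X \<omega>) = T x"
    and int: "has_bochner_integral lborel (\<lambda>x. indicator {0..} x * (real (Suc q) * x ^ q * T x)) c"
  shows "has_bochner_integral M (\<lambda>\<omega>. X \<omega> ^ Suc q) c"
proof -
  interpret pair_sigma_finite M lborel ..
  have T_nonneg: "0 \<le> T x" if "0 \<le> x" for x
    unfolding tail[OF that, symmetric] by simp
  have power: "ennreal (z ^ Suc q) =
      (\<integral>\<^sup>+x. ennreal (real (Suc q) * x ^ q) * indicator {0..<z} x \<partial>lborel)" if "0 \<le> z" for z :: real
  proof -
    \<comment> \<open>The half-open interval matches the strict event \<open>x < X \<omega>\<close>;
      closing it adds a null set.\<close>
    have "(\<integral>\<^sup>+x. ennreal (real (Suc q) * x ^ q) * indicator {0..<z} x \<partial>lborel) =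
        (\<integral>\<^sup>+x. ennreal (real (Suc q) * x ^ q) * indicator {0..z} x \<partial>lborel)"
      by (rule nn_integral_cong_AE, use AE_lborel_singleton[of z] in eventually_elim)
         (auto simp: indicator_def)
    also have "\<dots> = ennreal (z ^ Suc q - 0 ^ Suc q)"
    proof (rule nn_integral_FTC_Icc)
      fix x :: real assume "x \<in> {0..z}"
      show "((\<lambda>x. x ^ Suc q) has_real_derivative real (Suc q) * x ^ q) (at x)"
        using DERIV_pow[of "Suc q" x] by simp
      show "0 \<le> real (Suc q) * x ^ q" using \<open>x \<in> {0..z}\<close> by simp
    qed (use that in auto)
    finally show ?thesis by simp
  qed
  have "(\<integral>\<^sup>+\<omega>. ennreal (X \<omega> ^ Suc q) \<partial>M) =
     (\<integral>\<^sup>+\<omega>. (\<integral>\<^sup>+x. ennreal (real (Suc q) * x ^ q) * indicator {0..<X \<omega>} x \<partial>lborel) \<partial>M)"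
    by (rule nn_integral_cong_AE, use nn in eventually_elim) (rule power)
  also have "\<dots> = (\<integral>\<^sup>+x. (\<integral>\<^sup>+\<omega>. ennreal (real (Suc q) * x ^ q) * indicator {0..<X \<omega>} x \<partial>M) \<partial>lborel)"
    by (rule Fubini'[symmetric]) (simp add: indicator_def)
  also have "\<dots> = (\<integral>\<^sup>+x. ennreal (indicator {0..} x * (real (Suc q) * x ^ q * T x)) \<partial>lborel)"
  proof (rule nn_integral_cong)
    fix x :: real
    show "(\<integral>\<^sup>+\<omega>. ennreal (real (Suc q) * x ^ q) * indicator {0..<X \<omega>} x \<partial>M) =
        ennreal (indicator {0..} x * (real (Suc q) * x ^ q * T x))"
    proof (cases "0 \<le> x")
      case True
      have "(\<integral>\<^sup>+\<omega>. ennreal (real (Suc q) * x ^ q) * indicator {0..<X \<omega>} x \<partial>M) =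
        (\<integral>\<^sup>+\<omega>. ennreal (real (Suc q) * x ^ q) * indicator {\<omega>\<in>space M. x < X \<omega>} \<omega> \<partial>M)"
        using True by (intro nn_integral_cong) (auto simp: indicator_def)
      also have "\<dots> = ennreal (real (Suc q) * x ^ q) * emeasure M {\<omega>\<in>space M. x < X \<omega>}"
        by (rule nn_integral_cmult_indicator) simp
      also have "\<dots> = ennreal (real (Suc q) * x ^ q) * ennreal (T x)"
        by (simp only: emeasure_eq_measure tail[OF True])
      also have "\<dots> = ennreal (real (Suc q) * x ^ q * T x)"
        using True T_nonneg[OF True] by (intro ennreal_mult[symmetric]) auto
      finally show ?thesis using True by simp
    next
      case False
      then show ?thesis by (simp add: indicator_def)
    qed
  qed
  also have "\<dots> = ennreal (integral\<^sup>L lborel (\<lambda>x. indicator {0..} x * (real (Suc q) * x ^ q * T x)))"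
    using int T_nonneg
    by (intro nn_integral_eq_integral) (auto simp: has_bochner_integral_iff indicator_def)
  also have "\<dots> = ennreal c"
    using int by (simp add: has_bochner_integral_iff)
  finally have *: "(\<integral>\<^sup>+\<omega>. ennreal (X \<omega> ^ Suc q) \<partial>M) = ennreal c" .
  have "0 \<le> c"
  proof -
    have "0 \<le> integral\<^sup>L lborel (\<lambda>x. indicator {0..} x * (real (Suc q) * x ^ q * T x))"
      using T_nonneg by (intro Bochner_Integration.integral_nonneg) (auto simp: indicator_def)
    then show ?thesis using int by (simp add: has_bochner_integral_iff)
  qed
  have "AE \<omega> in M. 0 \<le> X \<omega> ^ Suc q" using nn by eventually_elim simp
  then show ?thesis
    by (intro has_bochner_integral_nn_integral) (use * \<open>0 \<le> c\<close> in simp_all)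
qed

text \<open>\<open>erlang_density 0 a\<close> is the exponential density, so this is its moment
  \<open>fact q / a ^ q\<close> divided by \<open>a\<close>.\<close>

lemma has_bochner_integral_power_exp:
  fixes a :: real
  assumes a: "0 < a"
  shows "has_bochner_integral lborel (\<lambda>x. indicator {0..} x * (x ^ q * exp (- a * x))) (fact q / a ^ Suc q)"
proof -
  have "has_bochner_integral lborel (\<lambda>x. erlang_density 0 a x * x ^ q) (fact q / a ^ q)"
  proof (rule has_bochner_integral_nn_integral)
    show "AE x in lborel. 0 \<le> erlang_density 0 a x * x ^ q"
      using a by (auto simp: erlang_density_def)
  qed (use nn_integral_erlang_ith_moment[OF a, of 0 q] a in simp_all)
  then have "has_bochner_integral lborel (\<lambda>x. 1 / a * (erlang_density 0 a x * x ^ q)) (1 / a * (fact q / a ^ q))"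
    by (rule has_bochner_integral_mult_right)
  moreover have "(\<lambda>x. 1 / a * (erlang_density 0 a x * x ^ q)) = (\<lambda>x. indicator {0..} x * (x ^ q * exp (- a * x)))"
    using a by (auto simp: erlang_density_def fun_eq_iff indicator_def)
  ultimately show ?thesis by simp
qed

section \<open>Beta values as alternating binomial sums\<close>

lemma Beta_1_left:
  fixes y :: real
  assumes "0 < y"
  shows "Beta 1 y = 1 / y"
  using assms Gamma_plus1[of y] less_imp_neq[OF Gamma_real_pos[OF assms]]
  by (simp add: Beta_def add.commute nonpos_Ints_def)

text \<open>Partial fractions of the Beta function. Pascal's rule splits the sum for
  \<open>Suc t\<close> into the sums for \<open>t\<close> at \<open>y\<close> and at
  \<open>y + 1\<close>, matching \<open>Beta (x + 1) y = Beta x y - Beta x (y + 1)\<close>; hence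
  \<open>y\<close> is arbitrary in the induction.\<close>

lemma Beta_Suc_eq_alternating_sum:
  fixes y :: real
  assumes "0 < y"
  shows "Beta (real (t + 1)) y = (\<Sum>j\<le>t. real (t choose j) * (-1) ^ j / (real j + y))"
  using assms
proof (induction t arbitrary: y)
  case 0
  then show ?case by (simp add: Beta_1_left)
next
  case (Suc t)
  let ?f = "\<lambda>j. (-1) ^ j / (real j + y)"
  have "(\<Sum>j\<le>Suc t. real (Suc t choose j) * (-1) ^ j / (real j + y)) =
     ?f 0 + (\<Sum>j\<le>t. real (Suc t choose Suc j) * ?f (Suc j))"
    by (subst sum.atMost_Suc_shift) simp
  also have "\<dots> = (?f 0 + (\<Sum>j\<le>t. real (t choose Suc j) * ?f (Suc j))) + (\<Sum>j\<le>t. real (t choose j) * ?f (Suc j))"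
    by (simp only: binomial_Suc_Suc of_nat_add distrib_right sum.distrib ac_simps)
  also have "?f 0 + (\<Sum>j\<le>t. real (t choose Suc j) * ?f (Suc j)) = (\<Sum>j\<le>Suc t. real (t choose j) * ?f j)"
    by (subst sum.atMost_Suc_shift) simp
  \<comment> \<open>The extra term \<open>j = Suc t\<close> has coefficient
    \<open>t choose Suc t = 0\<close>.\<close>
  also have "\<dots> = (\<Sum>j\<le>t. real (t choose j) * (-1) ^ j / (real j + y))"
    by simp
  also have "\<dots> = Beta (real (t + 1)) y"
    by (rule Suc.IH[symmetric]) (rule Suc.prems)
  also have "(\<Sum>j\<le>t. real (t choose j) * ?f (Suc j)) = - Beta (real (t + 1)) (y + 1)"
    using Suc.prems by (subst Suc.IH) (auto simp: sum_negf[symmetric] algebra_simps intro!: sum.cong)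
  also have "Beta (real (t + 1)) y + - Beta (real (t + 1)) (y + 1) = Beta (real (t + 1) + 1) y"
    using Beta_plus1_plus1[of "real (t + 1)" y] Suc.prems by (auto simp: nonpos_Ints_def)
  finally show ?case by (simp add: add.commute)
qed

lemma alternating_sum_inverse_Suc:
  "(\<Sum>l\<le>m. (-1) ^ l * real (m choose l) / real (l + 1)) = 1 / real (m + 1)"
  using Beta_Suc_eq_alternating_sum[of 1 m] Beta_1_left[of "real (m + 1)"]
  by (simp add: Beta_commute mult.commute add.commute)

text \<open>The tail of \<open>batch_service\<close> for independent exponential service times.\<close>

definition batch_tail :: "real \<Rightarrow> nat \<Rightarrow> nat \<Rightarrow> real \<Rightarrow> real" where
  "batch_tail mu r t x = exp (- mu * x) * (1 - (1 - exp (- mu * x)) ^ r) ^ t"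

text \<open>The binomial theorem, once for the power \<open>t\<close> and once for each resulting
  power \<open>r * j\<close>. The leading factor, from the systematic copy, shifts the exponent from
  \<open>l\<close> to \<open>l + 1\<close>.\<close>

lemma batch_tail_expand:
  "batch_tail mu r t x = (\<Sum>j\<le>t. real (t choose j) * (-1) ^ j *
     (\<Sum>l\<le>r * j. (-1) ^ l * real ((r * j) choose l) * exp (- (real (l + 1) * mu) * x)))"
proof -
  define e where "e = exp (- mu * x)"
  have pow: "(1 - z) ^ n = (\<Sum>l\<le>n. real (n choose l) * (-1) ^ l * z ^ l)" for z :: real and n
  proof -
    have "(1 - z) ^ n = (- z + 1) ^ n" by simp
    also have "\<dots> = (\<Sum>l\<le>n. real (n choose l) * (- z) ^ l)"
      by (subst binomial_ring) simp
    also have "\<dots> = (\<Sum>l\<le>n. real (n choose l) * (-1) ^ l * z ^ l)"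
      by (subst power_minus) (simp add: mult.assoc)
    finally show ?thesis .
  qed
  have e: "exp (- (real (l + 1) * mu) * x) = e * e ^ l" for l
    unfolding e_def exp_of_nat_mult[symmetric] exp_add[symmetric] by (simp add: algebra_simps)
  have "batch_tail mu r t x = e * (\<Sum>j\<le>t. real (t choose j) * (-1) ^ j * (1 - e) ^ (r * j))"
    unfolding batch_tail_def e_def[symmetric] by (subst pow) (simp add: power_mult)
  also have "\<dots> = (\<Sum>j\<le>t. real (t choose j) * (-1) ^ j *
     (\<Sum>l\<le>r * j. (-1) ^ l * real ((r * j) choose l) * (e * e ^ l)))"
    by (subst pow) (simp add: sum_distrib_left mult_ac)
  finally show ?thesis unfolding e .
qed

text \<open>Termwise integration: each exponential contributes
  \<open>fact q / (real (l + 1) * mu) ^ Suc q\<close>, and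
  \<open>Suc q * fact q = fact (Suc q)\<close>. The cases \<open>q = 0\<close> and
  \<open>q = 1\<close> give the mean and the second moment.\<close>

lemma has_bochner_integral_batch_tail:
  assumes mu: "0 < mu"
  shows "has_bochner_integral lborel (\<lambda>x. indicator {0..} x * (real (Suc q) * x ^ q * batch_tail mu r t x))
    (fact (Suc q) * (\<Sum>j\<le>t. real (t choose j) * (-1) ^ j *
      (\<Sum>l\<le>r * j. (-1) ^ l * real ((r * j) choose l) / real (l + 1) ^ Suc q)) / mu ^ Suc q)"
proof -
  let ?c = "\<lambda>j l. real (Suc q) * real (t choose j) * (-1) ^ j * ((-1) ^ l * real ((r * j) choose l))"
  have "has_bochner_integral lborel
     (\<lambda>x. \<Sum>j\<le>t. \<Sum>l\<le>r * j. ?c j l * (indicator {0..} x * (x ^ q * exp (- (real (l + 1) * mu) * x))))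
     (\<Sum>j\<le>t. \<Sum>l\<le>r * j. ?c j l * (fact q / (real (l + 1) * mu) ^ Suc q))"
    using mu
    by (intro has_bochner_integral_sum has_bochner_integral_mult_right has_bochner_integral_power_exp) auto
  moreover have "(\<lambda>x. indicator {0..} x * (real (Suc q) * x ^ q * batch_tail mu r t x)) =
     (\<lambda>x. \<Sum>j\<le>t. \<Sum>l\<le>r * j. ?c j l * (indicator {0..} x * (x ^ q * exp (- (real (l + 1) * mu) * x))))"
    by (rule ext, unfold batch_tail_expand sum_distrib_left, intro sum.cong refl) (simp only: mult_ac)
  moreover have "fact (Suc q) * (\<Sum>j\<le>t. real (t choose j) * (-1) ^ j *
      (\<Sum>l\<le>r * j. (-1) ^ l * real ((r * j) choose l) / real (l + 1) ^ Suc q)) / mu ^ Suc q =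
     (\<Sum>j\<le>t. \<Sum>l\<le>r * j. ?c j l * (fact q / (real (l + 1) * mu) ^ Suc q))"
    unfolding sum_distrib_left sum_divide_distrib power_mult_distrib fact_Suc
    by (intro sum.cong refl) (simp only: mult_ac times_divide_eq_right times_divide_eq_left divide_divide_eq_left)
  ultimately show ?thesis by simp
qed

text \<open>The inner sum is \<open>1 / real (r * j + 1)\<close>, and factoring out \<open>r\<close>
  leaves the partial fractions of a Beta value at \<open>y = 1 / r\<close>.\<close>

lemma batch_mean_eq_Beta:
  assumes r: "1 \<le> r"
  shows "(\<Sum>j\<le>t. real (t choose j) * (-1) ^ j *
      (\<Sum>l\<le>r * j. (-1) ^ l * real ((r * j) choose l) / real (l + 1))) =
    Beta (real (t + 1)) (1 / real r) / real r"
proof -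
  have *: "real (r * j + 1) = (real j + 1 / real r) * real r" for j
    using r by (simp add: algebra_simps)
  show ?thesis
    unfolding alternating_sum_inverse_Suc * using r
    by (subst Beta_Suc_eq_alternating_sum) (simp_all add: sum_divide_distrib)
qed

section \<open>The Fork-Join system\<close>

text \<open>A minimum over the fixed index set \<open>{..t}\<close>, with index \<open>t\<close>
  standing for the systematic copy, is the form to which measurability of finite minima
  applies.\<close>

lemma batch_service_eq_Min:
  "batch_service G t i Sm = Min ((\<lambda>j. if j < t then Max (Sm ` G i j) else Sm i) ` {..t})"
proof -
  have "insert (Sm i) ((\<lambda>j. Max (Sm ` G i j)) ` {..<t}) =
    (\<lambda>j. if j < t then Max (Sm ` G i j) else Sm i) ` {..t}"
    unfolding lessThan_Suc_atMost[symmetric] lessThan_Suc by auto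
  then show ?thesis
    by (simp add: batch_service_def)
qed

lemma borel_measurable_batch_service:
  assumes "\<And>j. j < t \<Longrightarrow> finite (G i j)"
    and "(\<lambda>x. f x i) \<in> borel_measurable N"
    and "\<And>j s. j < t \<Longrightarrow> s \<in> G i j \<Longrightarrow> (\<lambda>x. f x s) \<in> borel_measurable N"
  shows "(\<lambda>x. batch_service G t i (f x)) \<in> borel_measurable N"
proof -
  have "(\<lambda>x. if j < t then Max ((\<lambda>s. f x s) ` G i j) else f x i) \<in> borel_measurable N" for j
    using assms by (cases "j < t") (auto intro!: borel_measurable_Max)
  then show ?thesis
    unfolding batch_service_eq_Min by (intro borel_measurable_Min) auto
qed

lemma less_batch_service_iff:
  assumes "\<And>j. j < t \<Longrightarrow> finite (G i j) \<and> G i j \<noteq> {}"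
  shows "x < batch_service G t i Sm \<longleftrightarrow> x < Sm i \<and> (\<forall>j<t. \<exists>s\<in>G i j. x < Sm s)"
proof -
  have "x < Max (Sm ` G i j) \<longleftrightarrow> (\<exists>s\<in>G i j. x < Sm s)" if "j < t" for j
    using assms[OF that] by (subst Max_gr_iff) auto
  then show ?thesis
    unfolding batch_service_def by (subst Min_gr_iff) auto
qed

definition request_block :: "nat \<Rightarrow> rv_index set" where
  "request_block m = insert (FC m) (range (SV m))"

text \<open>The inputs behind the wait of request \<open>m\<close> in the bounding queues: the
  blocks of earlier requests and the gaps \<open>IA 1\<close> to \<open>IA m\<close>. They are
  disjoint from \<open>request_block m\<close> and exclude \<open>IA (Suc m)\<close>.\<close>

definition past_block :: "nat \<Rightarrow> rv_index set" where
  "past_block m = (\<Union>j<m. request_block j) \<union> (\<lambda>j. IA (Suc j)) ` {..<m}"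

locale fjga = prob_space M for M :: "'a measure" +
  fixes X :: "rv_index \<Rightarrow> 'a \<Rightarrow> real" and k r t :: nat and G :: "nat \<Rightarrow> nat \<Rightarrow> nat set"
    and p :: "nat \<Rightarrow> real" and lam mu :: real
  assumes indep: "indep_vars (\<lambda>_. borel) X UNIV"
    and dist_IA: "\<And>m. distributed M lborel (X (IA m)) (exponential_density lam)"
    and dist_SV: "\<And>m s. distributed M lborel (X (SV m s)) (exponential_density mu)"
    and prob_FC: "\<And>m i. i < k \<Longrightarrow> measure M {\<omega> \<in> space M. X (FC m) \<omega> = real i} = p i"
    and r_pos: "1 \<le> r"
    and p_sum: "(\<Sum>i<k. p i) = 1"
    and lam_pos: "0 < lam" and mu_pos: "0 < mu"
    and card_G: "\<And>i j. i < k \<Longrightarrow> j < t \<Longrightarrow> card (G i j) = r"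
    and notin_G: "\<And>i j. i < k \<Longrightarrow> j < t \<Longrightarrow> i \<notin> G i j"
    and disjoint_G: "\<And>i j j'. i < k \<Longrightarrow> j < t \<Longrightarrow> j' < t \<Longrightarrow> j \<noteq> j' \<Longrightarrow> G i j \<inter> G i j' = {}"
begin

lemma X_measurable [measurable]: "X v \<in> borel_measurable M"
  using indep by (auto simp: indep_vars_def)

lemma finite_G: "i < k \<Longrightarrow> j < t \<Longrightarrow> finite (G i j) \<and> G i j \<noteq> {}"
  using card_G[of i j] r_pos card_ge_0_finite[of "G i j"] by auto

lemma AE_IA_nonneg: "AE \<omega> in M. \<forall>m. 0 \<le> X (IA m) \<omega>"
  unfolding AE_all_countable
  by (intro allI, subst distributed_AE2[OF dist_IA]) (auto simp: exponential_density_def)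

lemma AE_SV_nonneg: "AE \<omega> in M. \<forall>m s. 0 \<le> X (SV m s) \<omega>"
  unfolding AE_all_countable
  by (intro allI, subst distributed_AE2[OF dist_SV]) (auto simp: exponential_density_def)

lemma AE_FC: "AE \<omega> in M. \<forall>m. \<exists>i<k. X (FC m) \<omega> = real i"
  unfolding AE_all_countable
proof
  fix m
  have "prob (\<Union>i<k. {\<omega> \<in> space M. X (FC m) \<omega> = real i}) =
      (\<Sum>i<k. prob {\<omega> \<in> space M. X (FC m) \<omega> = real i})"
    by (rule finite_measure_finite_Union) (auto simp: disjoint_family_on_def)
  then have "prob (\<Union>i<k. {\<omega> \<in> space M. X (FC m) \<omega> = real i}) = 1"
    using prob_FC p_sum by simp
  then show "AE \<omega> in M. \<exists>i<k. X (FC m) \<omega> = real i"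
    by (rule AE_prob_1[THEN AE_mp]) auto
qed

lemma file_req_eq: "X (FC m) \<omega> = real i \<Longrightarrow> file_req X \<omega> m = i"
  by (simp add: file_req_def)

lemma prob_SV_gt: "0 \<le> x \<Longrightarrow> prob (X (SV m s) -` {x<..} \<inter> space M) = exp (- mu * x)"
  using exponential_distributedD_gt[OF dist_SV _ mu_pos, of x m s]
  by (simp add: vimage_def Int_def conj_commute mult.commute)

lemma prob_SV_le: "0 \<le> x \<Longrightarrow> prob (X (SV m s) -` {..x} \<inter> space M) = 1 - exp (- mu * x)"
  using exponential_distributedD_le[OF dist_SV _ mu_pos, of x m s]
  by (simp add: vimage_def Int_def conj_commute mult.commute)

lemma prob_FC': "i < k \<Longrightarrow> prob (X (FC m) -` {real i} \<inter> space M) = p i"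
  using prob_FC[of i m] by (simp add: vimage_def Int_def conj_commute)

lemma prob_FC_Min_SV:
  assumes i: "i < k" and R: "finite R" "R \<noteq> {}" and x: "0 \<le> x"
  shows "\<P>(\<omega> in M. X (FC m) \<omega> = real i \<and> x < Min ((\<lambda>s. X (SV m s) \<omega>) ` R)) =
    p i * exp (- (real (card R) * mu) * x)"
proof -
  let ?A = "\<lambda>v. case v of FC _ \<Rightarrow> {real i} | _ \<Rightarrow> {x<..}"
  let ?J = "insert (FC m) (SV m ` R)"
  have "{\<omega>\<in>space M. X (FC m) \<omega> = real i \<and> x < Min ((\<lambda>s. X (SV m s) \<omega>) ` R)} =
    (\<Inter>v\<in>?J. X v -` ?A v \<inter> space M)"
    using R by auto
  also have "prob \<dots> = (\<Prod>v\<in>?J. prob (X v -` ?A v \<inter> space M))"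
    by (rule indep_varsD[OF indep]) (use R in \<open>auto split: rv_index.split\<close>)
  also have "\<dots> = p i * (\<Prod>s\<in>R. exp (- mu * x))"
    using R i x by (subst prod.insert) (auto simp: prod.reindex inj_on_def prob_FC' prob_SV_gt)
  finally show ?thesis
    by (simp add: exp_of_nat_mult[symmetric] mult_ac)
qed

text \<open>The file choice, the systematic service time and the recovery groups use disjoint sets
  of inputs, so their events are independent. A group outlasts \<open>x\<close> unless all of its
  \<open>r\<close> services have ended by \<open>x\<close>.\<close>

lemma prob_FC_batch_service:
  assumes i: "i < k" and x: "0 \<le> x"
  shows "\<P>(\<omega> in M. X (FC m) \<omega> = real i \<and> x < batch_service G t i (\<lambda>s. X (SV m s) \<omega>)) =
    p i * batch_tail mu r t x"
proof -
  \<comment> \<open>The \<open>t + 2\<close> independent blocks: index 0 is the file choice, index 1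
    the systematic service time and index \<open>j + 2\<close> recovery group
    \<open>j\<close>.\<close>
  define K where "K = case_nat {FC m} (case_nat {SV m i} (\<lambda>j. SV m ` G i j))"
  define Z where "Z l \<omega> = restrict (\<lambda>v. X v \<omega>) (K l)" for l \<omega>
  define A where "A = case_nat {f \<in> space (PiM (K 0) (\<lambda>_. borel :: real measure)). f (FC m) = real i}
     (case_nat {f \<in> space (PiM (K 1) (\<lambda>_. borel)). x < f (SV m i)}
       (\<lambda>j. {f \<in> space (PiM (K (Suc (Suc j))) (\<lambda>_. borel)). \<exists>s\<in>G i j. x < f (SV m s)}))"
  have K: "K 0 = {FC m}" "K (Suc 0) = {SV m i}" "K (Suc (Suc j)) = SV m ` G i j" for j
    by (simp_all add: K_def)
  have ind: "indep_vars (\<lambda>l. PiM (K l) (\<lambda>_. borel)) Z {..<Suc (Suc t)}"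
    unfolding Z_def
  proof (rule indep_vars_restrict[OF indep])
    \<comment> \<open>Here availability enters: the groups of a file are pairwise disjoint and avoid
      its systematic server.\<close>
    show "disjoint_family_on K {..<Suc (Suc t)}"
      unfolding disjoint_family_on_def
    proof safe
      fix l l' v assume "l < Suc (Suc t)" "l' < Suc (Suc t)" "l \<noteq> l'" "v \<in> K l" "v \<in> K l'"
      then show "v \<in> {}"
        using notin_G[OF i] disjoint_G[OF i]
        by (auto simp: K_def split: nat.splits)
    qed
  qed auto
  have Z0: "Z 0 -` A 0 \<inter> space M = X (FC m) -` {real i} \<inter> space M"
    and Z1: "Z (Suc 0) -` A (Suc 0) \<inter> space M = X (SV m i) -` {x<..} \<inter> space M"
    and Z2: "Z (Suc (Suc j)) -` A (Suc (Suc j)) \<inter> space M =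
      {\<omega>\<in>space M. \<exists>s\<in>G i j. x < X (SV m s) \<omega>}" for j
    by (auto simp: Z_def A_def K space_PiM)
  have "{\<omega>\<in>space M. X (FC m) \<omega> = real i \<and> x < batch_service G t i (\<lambda>s. X (SV m s) \<omega>)} =
     (\<Inter>l\<in>{..<Suc (Suc t)}. Z l -` A l \<inter> space M)"
    unfolding lessThan_Suc_eq_insert_0 image_insert INT_insert image_image INT_simps Z0 Z1 Z2
    using less_batch_service_iff[of t G i x] finite_G[OF i] by auto
  also have "prob \<dots> = (\<Prod>l\<in>{..<Suc (Suc t)}. prob (Z l -` A l \<inter> space M))"
  proof (rule indep_varsD_finite[OF ind])
    fix l assume l: "l \<in> {..<Suc (Suc t)}"
    have "{f \<in> space (PiM (SV m ` G i j) (\<lambda>_. borel)). \<exists>s\<in>G i j. x < f (SV m s)}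
        \<in> sets (PiM (SV m ` G i j) (\<lambda>_. borel))" if j: "j < t" for j
      using finite_G[OF i j] by (intro sets.sets_Collect_finite_Ex) auto
    moreover have "{f \<in> space (PiM {FC m} (\<lambda>_. borel)). f (FC m) = real i}
        \<in> sets (PiM {FC m} (\<lambda>_. borel))"
      "{f \<in> space (PiM {SV m i} (\<lambda>_. borel)). x < f (SV m i)}
        \<in> sets (PiM {SV m i} (\<lambda>_. borel))"
      by measurable
    ultimately show "A l \<in> sets (PiM (K l) (\<lambda>_. borel))"
      using l unfolding A_def K_def by (auto split: nat.split)
  qed auto
  also have "\<dots> = p i * exp (- mu * x) * (\<Prod>j<t. 1 - (1 - exp (- mu * x)) ^ r)"
  proof -
    have "prob (Z (Suc (Suc j)) -` A (Suc (Suc j)) \<inter> space M) = 1 - (1 - exp (- mu * x)) ^ r"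
      if j: "j < t" for j
    proof -
      let ?E = "\<Inter>v\<in>SV m ` G i j. X v -` {..x} \<inter> space M"
      have "Z (Suc (Suc j)) -` A (Suc (Suc j)) \<inter> space M = space M - ?E"
        unfolding Z2 using finite_G[OF i j] by (auto simp: not_le)
      moreover have "prob ?E = (\<Prod>v\<in>SV m ` G i j. prob (X v -` {..x} \<inter> space M))"
        by (rule indep_varsD[OF indep]) (use finite_G[OF i j] in auto)
      moreover have "\<dots> = (1 - exp (- mu * x)) ^ r"
        using x card_G[OF i j] by (simp add: prod.reindex inj_on_def prob_SV_le)
      moreover have "?E \<in> events"
        using finite_G[OF i j] by (intro sets.finite_INT) auto
      ultimately show ?thesis by (simp only: prob_compl)
    qed
    then have "(\<Prod>j<t. prob (Z (Suc (Suc j)) -` A (Suc (Suc j)) \<inter> space M)) =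
        (\<Prod>j<t. 1 - (1 - exp (- mu * x)) ^ r)"
      by (intro prod.cong) auto
    then show ?thesis
      by (simp only: prod.lessThan_Suc_shift Z0 Z1 prob_FC'[OF i] prob_SV_gt[OF x] mult.assoc)
  qed
  finally show ?thesis
    by (simp add: batch_tail_def mult.assoc)
qed

section \<open>Queues whose service times are functions of the request blocks\<close>

definition block_fun :: "(nat \<Rightarrow> (rv_index \<Rightarrow> real) \<Rightarrow> real) \<Rightarrow> nat \<Rightarrow> 'a \<Rightarrow> real" where
  "block_fun g m \<omega> = g m (restrict (\<lambda>v. X v \<omega>) (request_block m))"

text \<open>One construction for both bounds: \<open>g m\<close> reads a service time off the inputs
  of request \<open>m\<close>, while the gaps are the actual interarrival times, starting with
  \<open>IA 1\<close> between requests 0 and 1.\<close>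

definition waiting :: "(nat \<Rightarrow> (rv_index \<Rightarrow> real) \<Rightarrow> real) \<Rightarrow> nat \<Rightarrow> 'a \<Rightarrow> real" where
  "waiting g m \<omega> = lindley (\<lambda>j. block_fun g j \<omega>) (\<lambda>j. X (IA (Suc j)) \<omega>) m"

lemma measurable_lindley_past:
  assumes g: "\<And>m. g m \<in> borel_measurable (PiM (request_block m) (\<lambda>_. borel))"
    and J: "past_block m \<subseteq> J"
  shows "(\<lambda>f. lindley (\<lambda>j. g j (restrict f (request_block j))) (\<lambda>j. f (IA (Suc j))) m)
    \<in> borel_measurable (PiM J (\<lambda>_. borel))"
proof (rule borel_measurable_lindley)
  fix j assume j: "j < m"
  have "request_block j \<subseteq> J" and I: "IA (Suc j) \<in> J"
    using j J by (auto simp: past_block_def)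
  then show "(\<lambda>f. g j (restrict f (request_block j))) \<in> borel_measurable (PiM J (\<lambda>_. borel))"
    by (intro measurable_compose[OF measurable_restrict_subset g])
  show "(\<lambda>f. f (IA (Suc j))) \<in> borel_measurable (PiM J (\<lambda>_. borel))"
    using I by (rule measurable_component_singleton)
qed

text \<open>Writing the wait as a function of the inputs in \<open>J\<close> alone lets independence
  of disjoint families of inputs pass to it. \<open>J\<close> may exceed the past because the
  sojourn time also involves the block of request \<open>m\<close>.\<close>

lemma waiting_eq_past:
  assumes J: "past_block m \<subseteq> J"
  shows "waiting g m \<omega> = lindley (\<lambda>j. g j (restrict (restrict (\<lambda>v. X v \<omega>) J) (request_block j)))
    (\<lambda>j. restrict (\<lambda>v. X v \<omega>) J (IA (Suc j))) m"
  unfolding waiting_def block_fun_def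
proof (rule lindley_cong)
  fix j assume j: "j < m"
  then have "request_block j \<subseteq> J" and I: "IA (Suc j) \<in> J"
    using J by (auto simp: past_block_def)
  then show "g j (restrict (\<lambda>v. X v \<omega>) (request_block j)) =
      g j (restrict (restrict (\<lambda>v. X v \<omega>) J) (request_block j))"
    by (simp add: Int_absorb1)
  show "X (IA (Suc j)) \<omega> = restrict (\<lambda>v. X v \<omega>) J (IA (Suc j))"
    using I by simp
qed

text \<open>\<open>h\<close> is a free parameter because the lower bound needs the wait to be
  independent of the file choice as well as of the service time.\<close>

lemma indep_waiting_block:
  assumes g: "\<And>m. g m \<in> borel_measurable (PiM (request_block m) (\<lambda>_. borel))"
    and h: "h \<in> borel_measurable (PiM (request_block m) (\<lambda>_. borel))"
  shows "indep_var borel (waiting g m) borel (\<lambda>\<omega>. h (restrict (\<lambda>v. X v \<omega>) (request_block m)))"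
proof -
  have "indep_var (PiM (past_block m) (\<lambda>_. borel)) (\<lambda>\<omega>. restrict (\<lambda>v. X v \<omega>) (past_block m))
    (PiM (request_block m) (\<lambda>_. borel)) (\<lambda>\<omega>. restrict (\<lambda>v. X v \<omega>) (request_block m))"
    by (rule indep_var_restrict[OF indep]) (auto simp: past_block_def request_block_def)
  from indep_var_compose[OF this measurable_lindley_past[OF g order_refl] h]
  show ?thesis
    unfolding comp_def waiting_eq_past[OF order_refl, symmetric] .
qed

lemma indep_sojourn_IA:
  assumes g: "\<And>m. g m \<in> borel_measurable (PiM (request_block m) (\<lambda>_. borel))"
  shows "indep_var borel (\<lambda>\<omega>. waiting g m \<omega> + block_fun g m \<omega>) borel (X (IA (Suc m)))"
proof -
  let ?J = "past_block m \<union> request_block m"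
  have "indep_var (PiM ?J (\<lambda>_. borel)) (\<lambda>\<omega>. restrict (\<lambda>v. X v \<omega>) ?J)
    (PiM {IA (Suc m)} (\<lambda>_. borel)) (\<lambda>\<omega>. restrict (\<lambda>v. X v \<omega>) {IA (Suc m)})"
    by (rule indep_var_restrict[OF indep]) (auto simp: past_block_def request_block_def)
  moreover have "(\<lambda>f. lindley (\<lambda>j. g j (restrict f (request_block j))) (\<lambda>j. f (IA (Suc j))) m
      + g m (restrict f (request_block m))) \<in> borel_measurable (PiM ?J (\<lambda>_. borel))"
    by (intro borel_measurable_add measurable_lindley_past[OF g]
        measurable_compose[OF measurable_restrict_subset g]) auto
  moreover have "(\<lambda>f. f (IA (Suc m))) \<in> borel_measurable (PiM {IA (Suc m)} (\<lambda>_. borel))"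
    by (rule measurable_component_singleton) simp
  ultimately have "indep_var borel ((\<lambda>f. lindley (\<lambda>j. g j (restrict f (request_block j))) (\<lambda>j. f (IA (Suc j))) m
      + g m (restrict f (request_block m))) \<circ> (\<lambda>\<omega>. restrict (\<lambda>v. X v \<omega>) ?J))
     borel ((\<lambda>f. f (IA (Suc m))) \<circ> (\<lambda>\<omega>. restrict (\<lambda>v. X v \<omega>) {IA (Suc m)}))"
    by (rule indep_var_compose)
  moreover have "restrict (restrict f ?J) (request_block m) = restrict f (request_block m)" for f :: "rv_index \<Rightarrow> real"
    by (simp add: Int_absorb1)
  ultimately show ?thesis
    unfolding comp_def waiting_eq_past[OF Un_upper1, symmetric] block_fun_def by simp
qed

lemma mg1_waiting_block_fun:
  assumes g: "\<And>m. g m \<in> borel_measurable (PiM (request_block m) (\<lambda>_. borel))"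
    and nn: "\<And>m. AE \<omega> in M. 0 \<le> block_fun g m \<omega>"
    and tail: "\<And>m x. 0 \<le> x \<Longrightarrow> \<P>(\<omega> in M. x < block_fun g m \<omega>) = T x"
  shows "mg1_waiting M (waiting g) (block_fun g) (\<lambda>m. X (IA (Suc m))) (distr M borel (block_fun g 0)) lam"
proof
  show WB: "indep_var borel (waiting g m) borel (block_fun g m)" for m
    using indep_waiting_block[OF g g, of m] by (simp add: block_fun_def[abs_def])
  show "indep_var borel (\<lambda>\<omega>. waiting g m \<omega> + block_fun g m \<omega>) borel (X (IA (Suc m)))" for m
    by (rule indep_sojourn_IA[OF g])
  have [measurable]: "block_fun g m \<in> borel_measurable M" for m
    using indep_var_rv2[OF WB] .
  show "distr M borel (block_fun g m) = distr M borel (block_fun g 0)" for m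
    by (rule distr_eq_if_tail_eq) (simp_all add: nn tail)
qed (simp_all add: waiting_def nn dist_IA lam_pos)

lemma arrival_diff: "X (IA (Suc m)) \<omega> = arrival X \<omega> (Suc m) - arrival X \<omega> m"
  by (simp add: arrival_def)

section \<open>The dominating queue: one request at a time on all servers\<close>

definition batch_block :: "nat \<Rightarrow> (rv_index \<Rightarrow> real) \<Rightarrow> real" where
  "batch_block m f = (\<Sum>i<k. if f (FC m) = real i then batch_service G t i (\<lambda>s. f (SV m s)) else 0)"

lemma measurable_FC_block: "(\<lambda>f. f (FC m)) \<in> borel_measurable (PiM (request_block m) (\<lambda>_. borel))"
  and measurable_SV_block: "(\<lambda>f. f (SV m s)) \<in> borel_measurable (PiM (request_block m) (\<lambda>_. borel))"
  by (auto intro!: measurable_component_singleton simp: request_block_def)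

text \<open>Summing over the finitely many files, with each summand guarded by the file choice,
  makes the randomly selected \<open>batch_service\<close> a finite combination of measurable
  cases.\<close>

lemma measurable_batch_block: "batch_block m \<in> borel_measurable (PiM (request_block m) (\<lambda>_. borel))"
proof -
  note [measurable] = measurable_FC_block
  have [measurable]: "(\<lambda>f. batch_service G t i (\<lambda>s. f (SV m s))) \<in> borel_measurable (PiM (request_block m) (\<lambda>_. borel))"
    if "i < k" for i
    using that finite_G by (intro borel_measurable_batch_service measurable_SV_block) auto
  show ?thesis
    unfolding batch_block_def[abs_def]
    by (intro borel_measurable_sum measurable_If) (auto, measurable)
qed

lemma block_fun_batch:
  "block_fun batch_block m \<omega> =
    (\<Sum>i<k. if X (FC m) \<omega> = real i then batch_service G t i (\<lambda>s. X (SV m s) \<omega>) else 0)"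
  by (simp add: block_fun_def batch_block_def request_block_def cong: if_cong)

lemma block_fun_batch_eq:
  assumes "i < k" "X (FC m) \<omega> = real i"
  shows "block_fun batch_block m \<omega> = batch_service G t i (\<lambda>s. X (SV m s) \<omega>)"
  using assms by (simp add: block_fun_batch)

lemma block_fun_batch_nonneg: "AE \<omega> in M. 0 \<le> block_fun batch_block m \<omega>"
  using AE_SV_nonneg
proof eventually_elim
  case (elim \<omega>)
  then show ?case
    unfolding block_fun_batch using finite_G by (auto intro!: sum_nonneg batch_service_nonneg)
qed

text \<open>The tail given the requested file is the same for all files, so the weights
  \<open>p i\<close> sum out.\<close>

lemma block_fun_batch_tail:
  assumes x: "0 \<le> x"
  shows "\<P>(\<omega> in M. x < block_fun batch_block m \<omega>) = batch_tail mu r t x"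
proof -
  let ?E = "\<lambda>i. {\<omega>\<in>space M. X (FC m) \<omega> = real i \<and> x < batch_service G t i (\<lambda>s. X (SV m s) \<omega>)}"
  have "{\<omega>\<in>space M. x < block_fun batch_block m \<omega>} = (\<Union>i<k. ?E i)"
  proof (intro set_eqI iffI)
    fix \<omega> assume "\<omega> \<in> {\<omega>\<in>space M. x < block_fun batch_block m \<omega>}"
    then have \<omega>: "\<omega> \<in> space M" "x < block_fun batch_block m \<omega>" by auto
    \<comment> \<open>A value outside the valid files makes the sum zero, which cannot exceed
      \<open>x \<ge> 0\<close>; the set equality therefore holds without exceptional points.\<close>
    have "\<exists>i<k. X (FC m) \<omega> = real i"
    proof (rule ccontr)
      assume "\<not> (\<exists>i<k. X (FC m) \<omega> = real i)"
      then have "block_fun batch_block m \<omega> = 0"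
        unfolding block_fun_batch by (intro sum.neutral) auto
      with \<omega> x show False by simp
    qed
    then obtain i where i: "i < k" "X (FC m) \<omega> = real i" by auto
    with \<omega> show "\<omega> \<in> (\<Union>i<k. ?E i)"
      by (auto simp: block_fun_batch_eq)
  qed (auto simp: block_fun_batch_eq)
  moreover have "?E i \<in> events" if "i < k" for i
  proof -
    have [measurable]: "(\<lambda>\<omega>. batch_service G t i (\<lambda>s. X (SV m s) \<omega>)) \<in> borel_measurable M"
      using that finite_G by (intro borel_measurable_batch_service) auto
    show ?thesis by measurable
  qed
  then have "prob (\<Union>i<k. ?E i) = (\<Sum>i<k. prob (?E i))"
    by (intro finite_measure_finite_Union) (auto simp: disjoint_family_on_def)
  ultimately show ?thesis
    using p_sum x by (simp add: prob_FC_batch_service sum_distrib_right[symmetric])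
qed

lemma block_fun_batch_moment:
  "has_bochner_integral M (\<lambda>\<omega>. block_fun batch_block m \<omega> ^ Suc q)
    (fact (Suc q) * (\<Sum>j\<le>t. real (t choose j) * (-1) ^ j *
      (\<Sum>l\<le>r * j. (-1) ^ l * real ((r * j) choose l) / real (l + 1) ^ Suc q)) / mu ^ Suc q)"
proof (rule has_bochner_integral_power_tail[OF _ block_fun_batch_nonneg block_fun_batch_tail
      has_bochner_integral_batch_tail[OF mu_pos]])
  show "block_fun batch_block m \<in> borel_measurable M"
    using indep_var_rv2[OF indep_waiting_block[OF measurable_batch_block measurable_batch_block, of m]]
    by (simp add: block_fun_def[abs_def])
qed

lemma fjga_T_le: "AE \<omega> in M. fjga_T G t X m \<omega> \<le> waiting batch_block m \<omega> + block_fun batch_block m \<omega>"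
  using AE_IA_nonneg AE_SV_nonneg AE_FC
proof eventually_elim
  case (elim \<omega>)
  have fl: "file_req X \<omega> m < k" "X (FC m) \<omega> = real (file_req X \<omega> m)" for m
    using elim(3) file_req_eq by metis+
  show ?case
    unfolding fjga_T_def waiting_def
  proof (rule download_time_le_lindley)
    show "block_fun batch_block m \<omega> = batch_service G t (file_req X \<omega> m) (service X \<omega> m)" for m
      by (simp add: block_fun_batch_eq[OF fl] service_def[abs_def])
    show "finite (G (file_req X \<omega> m) j) \<and> G (file_req X \<omega> m) j \<noteq> {}" if "j < t" for m j
      using finite_G[OF fl(1) that] .
    show "0 \<le> arrival X \<omega> 0" using elim(1) by (simp add: arrival_def)
    show "0 \<le> service X \<omega> m s" for m s using elim(2) by (simp add: service_def)
  qed (rule arrival_diff)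
qed

text \<open>Mean wait plus mean service in the dominating queue. The second moment of the service
  time is \<open>2 * Q / mu ^ 2\<close>, and its factor 2 cancels against the one in the denominator
  of the Pollaczek-Khinchine value.\<close>

lemma fjga_ET_upper_bound:
  defines "eta \<equiv> Beta (real (t + 1)) (1 / real r) / (mu * real r)"
  assumes lam: "lam < 1 / eta"
  shows "fjga_ET M G t X m \<le> ennreal (eta + lam * (\<Sum>j\<le>t. real (t choose j) * (-1) ^ j *
           (\<Sum>l\<le>r * j. (-1) ^ l * real ((r * j) choose l) / real (l + 1) ^ 2))
           / (mu ^ 2 * (1 - lam * eta)))"
proof -
  define Q where "Q = (\<Sum>j\<le>t. real (t choose j) * (-1) ^ j *
           (\<Sum>l\<le>r * j. (-1) ^ l * real ((r * j) choose l) / real (l + 1) ^ 2))"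
  let ?B = "block_fun batch_block" and ?W = "waiting batch_block"
  interpret q: mg1_waiting M ?W ?B "\<lambda>m. X (IA (Suc m))" "distr M borel (?B 0)" lam
    by (rule mg1_waiting_block_fun[OF measurable_batch_block block_fun_batch_nonneg block_fun_batch_tail])
  have m1: "has_bochner_integral M (?B m) eta" for m
    using block_fun_batch_moment[of m 0] batch_mean_eq_Beta[OF r_pos, of t]
    by (simp add: eta_def mult.commute)
  have m2: "has_bochner_integral M (\<lambda>\<omega>. ?B 0 \<omega> ^ 2) (2 * Q / mu ^ 2)"
    using block_fun_batch_moment[of 0 1] unfolding Q_def by (simp add: numeral_2_eq_2)
  have int2: "integrable M (\<lambda>\<omega>. ?B 0 \<omega> ^ 2)" and E2: "expectation (\<lambda>\<omega>. ?B 0 \<omega> ^ 2) = 2 * Q / mu ^ 2"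
    and int1: "integrable M (?B m)" and E1: "expectation (?B m) = eta" for m
    using m1 m2 by (auto simp: has_bochner_integral_iff)
  \<comment> \<open>As a mean, \<open>eta\<close> is nonnegative. It is not 0, since then
    \<open>1 / eta = 0\<close> by the convention for division and the positive \<open>lam\<close>
    would lie below 0.\<close>
  have "0 \<le> eta"
    unfolding E1[of 0, symmetric] by (rule integral_nonneg_AE[OF block_fun_batch_nonneg])
  with lam lam_pos have eta: "0 < eta" by (cases "eta = 0") auto
  with lam have rho: "lam * eta < 1" by (simp add: field_simps)
  have "integrable M (\<lambda>\<omega>. ?B 0 \<omega> ^ 1)" using int1[of 0] by simp
  from q.integrable_W_power[OF this] have intW: "integrable M (?W m)" by simp
  have "fjga_ET M G t X m \<le> (\<integral>\<^sup>+\<omega>. ennreal (?W m \<omega> + ?B m \<omega>) \<partial>M)"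
    unfolding fjga_ET_def
    by (rule nn_integral_mono_AE, use fjga_T_le[of m] in eventually_elim) (rule ennreal_leI)
  also have "\<dots> = ennreal (expectation (\<lambda>\<omega>. ?W m \<omega> + ?B m \<omega>))"
  proof (rule nn_integral_eq_integral)
    show "AE \<omega> in M. 0 \<le> ?W m \<omega> + ?B m \<omega>"
      using block_fun_batch_nonneg[of m] by eventually_elim (simp add: q.W_nonneg)
  qed (use intW int1 in simp)
  also have "expectation (\<lambda>\<omega>. ?W m \<omega> + ?B m \<omega>) = expectation (?W m) + eta"
    using intW int1 E1 by simp
  also have "ennreal \<dots> \<le> ennreal (eta + lam * Q / (mu ^ 2 * (1 - lam * eta)))"
  proof (rule ennreal_leI)
    have "expectation (?W m) \<le> lam * (2 * Q / mu ^ 2) / (2 * (1 - lam * eta))"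
      using q.pollaczek_khinchine_le[OF int2, of m] rho unfolding E1 E2 by simp
    also have "\<dots> = lam * Q / (mu ^ 2 * (1 - lam * eta))"
    proof -
      have "lam * (2 * Q / b) / (2 * d) = lam * Q / (b * d)" for b d :: real by simp
      then show ?thesis .
    qed
    finally show "expectation (?W m) + eta \<le> eta + lam * Q / (mu ^ 2 * (1 - lam * eta))" by simp
  qed
  finally show ?thesis unfolding Q_def .
qed

section \<open>The dominated queues: one per file, on one server per group\<close>

definition representatives :: "nat \<Rightarrow> nat set" where
  "representatives i = insert i ((\<lambda>j. SOME s. s \<in> G i j) ` {..<t})"

text \<open>Disjoint groups avoiding server \<open>i\<close> give distinct representatives, so
  exactly \<open>t + 1\<close> exponential times compete; meeting every group is what
  \<open>compl_time_ge\<close> asks for.\<close>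

lemma representatives:
  assumes i: "i < k"
  shows "finite (representatives i)" "i \<in> representatives i"
    "representatives i \<subseteq> used_servers G t i"
    "\<And>j. j < t \<Longrightarrow> G i j \<inter> representatives i \<noteq> {}"
    "card (representatives i) = t + 1"
proof -
  define rep where "rep j = (SOME s. s \<in> G i j)" for j
  have rep: "rep j \<in> G i j" if "j < t" for j
    using finite_G[OF i that] unfolding rep_def by (simp add: some_in_eq)
  have R: "representatives i = insert i (rep ` {..<t})"
    by (simp add: representatives_def rep_def)
  show "finite (representatives i)" "i \<in> representatives i"
    by (simp_all add: R)
  show "representatives i \<subseteq> used_servers G t i"
    using rep by (auto simp: R used_servers_def)
  show "G i j \<inter> representatives i \<noteq> {}" if "j < t" for j
    using rep[OF that] that by (auto simp: R)
  have "inj_on rep {..<t}"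
  proof (rule inj_onI)
    fix j j' assume "j \<in> {..<t}" "j' \<in> {..<t}" "rep j = rep j'"
    then show "j = j'"
      using rep[of j] rep[of j'] disjoint_G[OF i, of j j'] by auto
  qed
  moreover have "i \<notin> rep ` {..<t}"
    using rep notin_G[OF i] by auto
  ultimately show "card (representatives i) = t + 1"
    by (simp add: R card_image)
qed

text \<open>Requests for other files remain in the stream with service time 0. The queue then keeps
  Poisson arrivals at rate \<open>lam\<close>, and thinning by \<open>p i\<close> moves into the law
  of the service time.\<close>

definition min_block :: "nat \<Rightarrow> nat \<Rightarrow> (rv_index \<Rightarrow> real) \<Rightarrow> real" where
  "min_block i m f = (if f (FC m) = real i then Min ((\<lambda>s. f (SV m s)) ` representatives i) else 0)"

lemma measurable_min_block:
  assumes "i < k"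
  shows "min_block i m \<in> borel_measurable (PiM (request_block m) (\<lambda>_. borel))"
proof -
  note [measurable] = measurable_FC_block
  have [measurable]: "(\<lambda>f. Min ((\<lambda>s. f (SV m s)) ` representatives i) :: real)
      \<in> borel_measurable (PiM (request_block m) (\<lambda>_. borel))"
    by (intro borel_measurable_Min representatives(1)[OF assms] measurable_SV_block)
  show ?thesis
    unfolding min_block_def[abs_def] by measurable
qed

lemma block_fun_min:
  "block_fun (min_block i) m \<omega> =
    (if X (FC m) \<omega> = real i then Min ((\<lambda>s. X (SV m s) \<omega>) ` representatives i) else 0)"
  by (simp add: block_fun_def min_block_def request_block_def cong: if_cong)

lemma block_fun_min_nonneg:
  assumes "i < k"
  shows "AE \<omega> in M. 0 \<le> block_fun (min_block i) m \<omega>"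
  using AE_SV_nonneg
proof eventually_elim
  case (elim \<omega>)
  have "representatives i \<noteq> {}"
    using representatives(2)[OF assms] by auto
  with elim show ?case
    unfolding block_fun_min using representatives(1)[OF assms] by (auto simp: Min_ge_iff)
qed

lemma block_fun_min_tail:
  assumes i: "i < k" and x: "0 \<le> x"
  shows "\<P>(\<omega> in M. x < block_fun (min_block i) m \<omega>) = p i * exp (- (real (t + 1) * mu) * x)"
proof -
  have "{\<omega>\<in>space M. x < block_fun (min_block i) m \<omega>} =
    {\<omega>\<in>space M. X (FC m) \<omega> = real i \<and> x < Min ((\<lambda>s. X (SV m s) \<omega>) ` representatives i)}"
    using x unfolding block_fun_min by auto
  moreover have "representatives i \<noteq> {}"
    using representatives(2)[OF i] by auto
  ultimately show ?thesis
    using prob_FC_Min_SV[OF i representatives(1)[OF i] _ x] representatives(5)[OF i] by simp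
qed

lemma block_fun_min_moment:
  assumes i: "i < k"
  shows "has_bochner_integral M (\<lambda>\<omega>. block_fun (min_block i) m \<omega> ^ Suc q)
    (p i * fact (Suc q) / (real (t + 1) * mu) ^ Suc q)"
proof (rule has_bochner_integral_power_tail[OF _ block_fun_min_nonneg[OF i] block_fun_min_tail[OF i]])
  show "block_fun (min_block i) m \<in> borel_measurable M"
    using indep_var_rv2[OF indep_waiting_block[OF measurable_min_block[OF i] measurable_min_block[OF i], of m]]
    by (simp add: block_fun_def[abs_def])
  have "has_bochner_integral lborel (\<lambda>x. real (Suc q) * p i * (indicator {0..} x * (x ^ q * exp (- (real (t + 1) * mu) * x))))
     (real (Suc q) * p i * (fact q / (real (t + 1) * mu) ^ Suc q))"
    using mu_pos by (intro has_bochner_integral_mult_right has_bochner_integral_power_exp) auto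
  then show "has_bochner_integral lborel
     (\<lambda>x. indicator {0..} x * (real (Suc q) * x ^ q * (p i * exp (- (real (t + 1) * mu) * x))))
     (p i * fact (Suc q) / (real (t + 1) * mu) ^ Suc q)"
    by (simp only: fact_Suc mult_ac times_divide_eq_right)
qed

text \<open>On almost every path exactly one file is requested, so the sum reduces to one queue. The
  wait needs an indicator to select it, whereas \<open>block_fun (min_block i) m\<close> already
  vanishes for other files.\<close>

lemma fjga_T_ge:
  "AE \<omega> in M. (\<Sum>i<k. indicator {real i} (X (FC m) \<omega>) * waiting (min_block i) m \<omega>
      + block_fun (min_block i) m \<omega>) \<le> fjga_T G t X m \<omega>"
  using AE_IA_nonneg AE_SV_nonneg AE_FC
proof eventually_elim
  case (elim \<omega>)
  obtain i where i: "i < k" "X (FC m) \<omega> = real i"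
    using elim(3) by auto
  have fl: "X (FC m) \<omega> = real (file_req X \<omega> m)" for m
    using elim(3) file_req_eq by metis
  have "(\<Sum>i'<k. indicator {real i'} (X (FC m) \<omega>) * waiting (min_block i') m \<omega>
      + block_fun (min_block i') m \<omega>) =
    (\<Sum>i'<k. if i' = i then waiting (min_block i) m \<omega> + block_fun (min_block i) m \<omega> else 0)"
    using i by (intro sum.cong) (auto simp: block_fun_min)
  also have "\<dots> = waiting (min_block i) m \<omega> + Min (service X \<omega> m ` representatives i)"
    using i by (simp add: block_fun_min service_def[abs_def])
  also have "\<dots> \<le> fjga_T G t X m \<omega>"
    unfolding fjga_T_def waiting_def
  proof (rule lindley_le_download_time)
    show "block_fun (min_block i) m \<omega> =
        (if file_req X \<omega> m = i then Min (service X \<omega> m ` representatives i) else 0)" for m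
      by (simp add: block_fun_min fl service_def[abs_def])
    show "file_req X \<omega> m = i"
      using i by (intro file_req_eq) simp
    show "X (IA (Suc m)) \<omega> = arrival X \<omega> (Suc m) - arrival X \<omega> m" for m
      by (rule arrival_diff)
  qed (use finite_G[OF i(1)] representatives[OF i(1)] elim(1) in auto)
  finally show ?case .
qed

lemma waiting_nonneg: "0 \<le> waiting g m \<omega>"
  by (simp add: waiting_def lindley_nonneg)

text \<open>With \<open>nu = real (t + 1) * mu\<close>, file \<open>i\<close> contributes
  \<open>p i\<close> times its mean wait plus \<open>p i / nu\<close>. These lower bounds at each
  \<open>m\<close> converge by \<open>pollaczek_khinchine_tendsto\<close>, and their limit bounds
  the liminf.\<close>

lemma fjga_ET_lower_bound:
  assumes lam: "lam < real (t + 1) * mu / Max (p ` {..<k})"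
  shows "ennreal (\<Sum>i<k. p i / (real (t + 1) * mu - p i * lam)) \<le> liminf (fjga_ET M G t X)"
proof -
  define nu where "nu = real (t + 1) * mu"
  have nu: "0 < nu" using mu_pos by (simp add: nu_def)
  let ?B = "\<lambda>i. block_fun (min_block i)" and ?W = "\<lambda>i. waiting (min_block i)"
  have stable: "p i * lam < nu" if i: "i < k" for i
  proof -
    have le: "p j \<le> Max (p ` {..<k})" if "j < k" for j
      using that by (intro Max_ge) auto
    \<comment> \<open>Since the \<open>p i\<close> sum to 1, the maximum is positive, and the
      hypothesis on \<open>lam\<close> can be multiplied out.\<close>
    have "0 < Max (p ` {..<k})"
    proof (rule ccontr)
      assume "\<not> 0 < Max (p ` {..<k})"
      then have "p j \<le> 0" if "j < k" for j using le[OF that] by linarith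
      then have "(\<Sum>i<k. p i) \<le> 0" by (intro sum_nonpos) auto
      then show False using p_sum by simp
    qed
    then have "lam * Max (p ` {..<k}) < nu"
      using lam by (simp add: nu_def field_simps)
    moreover have "p i * lam \<le> lam * Max (p ` {..<k})"
      using le[OF i] lam_pos by (simp add: mult.commute)
    ultimately show ?thesis by linarith
  qed
  have queue: "mg1_waiting M (?W i) (?B i) (\<lambda>m. X (IA (Suc m))) (distr M borel (?B i 0)) lam"
    if i: "i < k" for i
    by (rule mg1_waiting_block_fun[OF measurable_min_block[OF i] block_fun_min_nonneg[OF i] block_fun_min_tail[OF i]])
  have moment: "has_bochner_integral M (\<lambda>\<omega>. ?B i m \<omega> ^ Suc q) (p i * fact (Suc q) / nu ^ Suc q)"
    if i: "i < k" for i m q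
    unfolding nu_def by (rule block_fun_min_moment[OF i])
  have int1: "integrable M (?B i m)" and E1: "expectation (?B i m) = p i / nu" if i: "i < k" for i m
    using moment[OF i, of m 0] by (auto simp: has_bochner_integral_iff)
  have E2: "expectation (\<lambda>\<omega>. ?B i m \<omega> ^ 2) = p i * 2 / nu ^ 2" if i: "i < k" for i m
    using moment[OF i, of m 1] by (auto simp: has_bochner_integral_iff numeral_2_eq_2)
  have int3: "integrable M (\<lambda>\<omega>. ?B i m \<omega> ^ 3)" if i: "i < k" for i m
    using moment[OF i, of m 2] by (auto simp: has_bochner_integral_iff numeral_3_eq_3)
  have intW: "integrable M (?W i m)" if i: "i < k" for i m
  proof -
    interpret q: mg1_waiting M "?W i" "?B i" "\<lambda>m. X (IA (Suc m))" "distr M borel (?B i 0)" lam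
      by (rule queue[OF i])
    have "integrable M (\<lambda>\<omega>. ?B i 0 \<omega> ^ 1)" using int1[OF i] by simp
    from q.integrable_W_power[OF this] show ?thesis by simp
  qed
  \<comment> \<open>The wait before request \<open>m\<close> depends on the past only, so it is
    independent of the file that request \<open>m\<close> asks for, and the indicator contributes
    the factor \<open>p i\<close>.\<close>
  have thin: "integrable M (\<lambda>\<omega>. indicator {real i} (X (FC m) \<omega>) * ?W i m \<omega>)"
      "expectation (\<lambda>\<omega>. indicator {real i} (X (FC m) \<omega>) * ?W i m \<omega>) = p i * expectation (?W i m)"
    if i: "i < k" for i m
  proof -
    have "(\<lambda>f. indicator {real i} (f (FC m)) :: real) \<in> borel_measurable (PiM (request_block m) (\<lambda>_. borel))"
      by (rule measurable_compose[OF measurable_FC_block]) simp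
    from indep_waiting_block[OF measurable_min_block[OF i] this]
    have ind: "indep_var borel (?W i m) borel (\<lambda>\<omega>. indicator {real i} (X (FC m) \<omega>) :: real)"
      by (simp add: request_block_def)
    have int: "integrable M (\<lambda>\<omega>. indicator {real i} (X (FC m) \<omega>) :: real)"
      by (rule integrable_const_bound[where B=1]) auto
    have "expectation (\<lambda>\<omega>. indicator {real i} (X (FC m) \<omega>)) =
        expectation (indicator {\<omega>\<in>space M. X (FC m) \<omega> = real i})"
      by (rule Bochner_Integration.integral_cong) (auto simp: indicator_def)
    also have "\<dots> = p i"
      using prob_FC[OF i, of m] by simp
    finally have E: "expectation (\<lambda>\<omega>. indicator {real i} (X (FC m) \<omega>)) = p i" .
    show "integrable M (\<lambda>\<omega>. indicator {real i} (X (FC m) \<omega>) * ?W i m \<omega>)"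
      using indep_var_integrable[OF ind intW[OF i] int] by (simp only: mult.commute)
    show "expectation (\<lambda>\<omega>. indicator {real i} (X (FC m) \<omega>) * ?W i m \<omega>) = p i * expectation (?W i m)"
      using indep_var_lebesgue_integral[OF ind intW[OF i] int] E by (simp only: mult.commute)
  qed
  have lower: "ennreal (\<Sum>i<k. p i * expectation (?W i m) + p i / nu) \<le> fjga_ET M G t X m" for m
  proof -
    let ?L = "\<lambda>\<omega>. \<Sum>i<k. indicator {real i} (X (FC m) \<omega>) * ?W i m \<omega> + ?B i m \<omega>"
    have "expectation ?L = (\<Sum>i<k. p i * expectation (?W i m) + p i / nu)"
      using thin int1 E1 by simp
    moreover have "(\<integral>\<^sup>+\<omega>. ennreal (?L \<omega>) \<partial>M) = ennreal (expectation ?L)"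
    proof (rule nn_integral_eq_integral)
      show "integrable M ?L"
        by (intro Bochner_Integration.integrable_sum Bochner_Integration.integrable_add thin int1) auto
      have "AE \<omega> in M. \<forall>i<k. 0 \<le> ?B i m \<omega>"
        using block_fun_min_nonneg by (simp add: AE_all_countable)
      then show "AE \<omega> in M. 0 \<le> ?L \<omega>"
        by eventually_elim (auto intro!: sum_nonneg add_nonneg_nonneg mult_nonneg_nonneg simp: waiting_nonneg)
    qed
    moreover have "(\<integral>\<^sup>+\<omega>. ennreal (?L \<omega>) \<partial>M) \<le> fjga_ET M G t X m"
      unfolding fjga_ET_def
      by (rule nn_integral_mono_AE, use fjga_T_ge[of m] in eventually_elim) (rule ennreal_leI)
    ultimately show ?thesis by simp
  qed
  have lim: "(\<lambda>m. p i * expectation (?W i m) + p i / nu) \<longlonglongrightarrow> p i / (nu - p i * lam)" if i: "i < k" for i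
  proof -
    interpret q: mg1_waiting M "?W i" "?B i" "\<lambda>m. X (IA (Suc m))" "distr M borel (?B i 0)" lam
      by (rule queue[OF i])
    have "lam * expectation (?B i 0) < 1"
      using stable[OF i] nu by (simp add: E1[OF i] field_simps)
    from q.pollaczek_khinchine_tendsto[OF int3[OF i] this]
    have "(\<lambda>m. p i * expectation (?W i m) + p i / nu) \<longlonglongrightarrow>
        p i * (lam * (p i * 2 / nu ^ 2) / (2 * (1 - lam * (p i / nu)))) + p i / nu"
      unfolding E1[OF i] E2[OF i] by (intro tendsto_intros)
    also have "p i * (lam * (p i * 2 / nu ^ 2) / (2 * (1 - lam * (p i / nu)))) + p i / nu = p i / (nu - p i * lam)"
    proof -
      \<comment> \<open>Over the denominator \<open>nu * c\<close> the numerator is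
        \<open>p i * (lam * p i + c)\<close>, and \<open>lam * p i + c = nu\<close> cancels one
        factor.\<close>
      define c where "c = nu - p i * lam"
      have c: "0 < c" using stable[OF i] by (simp add: c_def)
      have rho: "1 - lam * (p i / nu) = c / nu"
        using nu by (simp add: c_def field_simps)
      have "x * (l * (x * 2 / v ^ 2) / (2 * (d / v))) + x / v = x * (l * x + d) / (v * d)"
        if "0 < v" "0 < d" for x l v d :: real
        using that by (simp add: power2_eq_square field_simps)
      from this[OF nu c]
      have "p i * (lam * (p i * 2 / nu ^ 2) / (2 * (1 - lam * (p i / nu)))) + p i / nu
          = p i * (lam * p i + c) / (nu * c)"
        unfolding rho .
      also have "lam * p i + c = nu" by (simp add: c_def)
      finally show ?thesis using nu by (simp add: c_def)
    qed
    finally show ?thesis .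
  qed
  have "(\<lambda>m. ennreal (\<Sum>i<k. p i * expectation (?W i m) + p i / nu)) \<longlonglongrightarrow>
      ennreal (\<Sum>i<k. p i / (nu - p i * lam))"
    by (intro tendsto_ennrealI tendsto_sum) (use lim in auto)
  then have "ennreal (\<Sum>i<k. p i / (nu - p i * lam)) =
      liminf (\<lambda>m. ennreal (\<Sum>i<k. p i * expectation (?W i m) + p i / nu))"
    by (intro lim_imp_Liminf[symmetric]) auto
  also have "\<dots> \<le> liminf (fjga_ET M G t X)"
    by (intro Liminf_mono always_eventually allI lower)
  finally show ?thesis unfolding nu_def .
qed

end

text \<open>The system starts empty, and steady state is expressed through the mean download time of
  request \<open>m\<close> as \<open>m\<close> grows: a lower bound on the liminf and an upper bound
  on the limsup hold for every limit point of these means. Means are taken in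
  \<open>ennreal\<close>, so the upper bound includes finiteness of the limsup.\<close>

theorem theorem3:
  fixes M :: "'a measure" and X :: "rv_index \<Rightarrow> 'a \<Rightarrow> real"
    and n k r t :: nat and G :: "nat \<Rightarrow> nat \<Rightarrow> nat set"
    and p :: "nat \<Rightarrow> real" and lam mu :: real
  assumes "prob_space M"
    and "prob_space.indep_vars M (\<lambda>_. borel) X UNIV"
    and "\<And>m. distributed M lborel (X (IA m)) (exponential_density lam)"
    and "\<And>m s. distributed M lborel (X (SV m s)) (exponential_density mu)"
    and "\<And>m i. i < k \<Longrightarrow> measure M {\<omega> \<in> space M. X (FC m) \<omega> = real i} = p i"
    and "1 \<le> k" and "k \<le> n" and "1 \<le> r"
    and "\<And>i. i < k \<Longrightarrow> p i \<ge> 0" and "(\<Sum>i<k. p i) = 1"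
    and "0 < lam" and "0 < mu"
    and "\<And>i j. i < k \<Longrightarrow> j < t \<Longrightarrow> G i j \<subseteq> {..<n}"
    and "\<And>i j. i < k \<Longrightarrow> j < t \<Longrightarrow> card (G i j) = r"
    and "\<And>i j. i < k \<Longrightarrow> j < t \<Longrightarrow> i \<notin> G i j"
    and "\<And>i j j'. i < k \<Longrightarrow> j < t \<Longrightarrow> j' < t \<Longrightarrow> j \<noteq> j' \<Longrightarrow> G i j \<inter> G i j' = {}"
  shows "(lam < real (t + 1) * mu / Max (p ` {..<k}) \<longrightarrow>
           ennreal (\<Sum>i<k. p i / (real (t + 1) * mu - p i * lam))
             \<le> liminf (fjga_ET M G t X)) \<and>
         (let eta = Beta (real (t + 1)) (1 / real r) / (mu * real r) in
         lam < 1 / eta \<longrightarrow>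
           limsup (fjga_ET M G t X)
             \<le> ennreal (eta + lam * (\<Sum>j\<le>t. real (t choose j) * (-1) ^ j *
                   (\<Sum>l\<le>r * j. (-1) ^ l * real ((r * j) choose l) / real (l + 1) ^ 2))
                   / (mu ^ 2 * (1 - lam * eta))))"
proof -
  interpret fjga M X k r t G p lam mu
    by (intro fjga.intro fjga_axioms.intro) (fact assms)+
  have "limsup (fjga_ET M G t X) \<le> ennreal c" if "\<And>m. fjga_ET M G t X m \<le> ennreal c" for c
    using that by (intro Limsup_bounded always_eventually) auto
  then show ?thesis
    unfolding Let_def using fjga_ET_lower_bound fjga_ET_upper_bound by blast
qed

end
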